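(* Let $\varepsilon>0$. If $\lambda>\lambda_0=3/2^{2/3}$ and there is an $\bar\alpha\in(\alpha_0,-\sqrt{\lambda/3})$ such that $u_{\bar\alpha}(t)$ increases monotonically as $t$ increases from $0$ and crosses $u=b$ before $t=\pi/2$, then there are at least five $2\pi$-periodic solutions of $\varepsilon^2u''=u^3-\lambda u+\cos t$, namely $u_1,u_2,u_3\,(=u_p),u_4$ and $u_5$, all with $u'(\pi)=0$. Further, these solutions are ordered by $u_1<u_2<u_3<u_4<u_5$.
   Context: For $\alpha\in\mathbb{R}$, $u_\alpha$ denotes the solution of $\varepsilon^2u''=u^3-\lambda u+\cos t$ with $u(0)=\alpha$, $u'(0)=0$. The number $b>0$ is fixed with $b^3-\lambda b-1>0$. $\alpha_0$ is the smallest real root of $u^3-\lambda u+1=0$. Known solutions: $u_1$ and $u_5$ are the unique solutions with $u'(0)=0$, bounded on $[0,\infty)$, satisfying respectively $u_1<0,\ 3u_1^2-\lambda>0$ and $u_5>0,\ 3u_5^2-\lambda>0$ (they are $2\pi$-periodic); $u_p$ is the unique $2\pi$-periodic solution with $u'(0)=0$, $u(\pi/2)=0$ and $u'>0$ on $(0,\pi/2)$. *)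

theory Defs
  imports "HOL-Analysis.Analysis"
begin

text \<open>Solutions of \<open>\<epsilon>\<^sup>2 u'' = u\<^sup>3 - lam u + cos t\<close> on a set \<open>S\<close>; derivatives are taken within
  \<open>S\<close>, hence one-sided at the end points of a closed interval.\<close>

definition solves_on :: "real \<Rightarrow> real \<Rightarrow> real set \<Rightarrow> (real \<Rightarrow> real) \<Rightarrow> bool" where
  "solves_on \<epsilon> lam S u \<longleftrightarrow>
     (\<exists>u' u''. \<forall>t\<in>S. (u has_real_derivative u' t) (at t within S)
                  \<and> (u' has_real_derivative u'' t) (at t within S)
                  \<and> \<epsilon>^2 * u'' t = (u t)^3 - lam * u t + cos t)"

text \<open>\<open>u\<close> agrees on \<open>S\<close> with the solution \<open>u\<^sub>\<alpha>\<close>. Since solutions may blow up in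
  finite time, \<open>u\<^sub>\<alpha>\<close> is only referred to on intervals \<open>S\<close> containing \<open>0\<close> on which it exists.\<close>

definition shoots_on :: "real \<Rightarrow> real \<Rightarrow> real \<Rightarrow> real set \<Rightarrow> (real \<Rightarrow> real) \<Rightarrow> bool" where
  "shoots_on \<epsilon> lam \<alpha> S u \<longleftrightarrow>
     solves_on \<epsilon> lam S u \<and> u 0 = \<alpha> \<and> (u has_real_derivative 0) (at 0 within S)"

definition periodic_solution :: "real \<Rightarrow> real \<Rightarrow> (real \<Rightarrow> real) \<Rightarrow> bool" where
  "periodic_solution \<epsilon> lam u \<longleftrightarrow> solves_on \<epsilon> lam UNIV u \<and> (\<forall>t. u (t + 2 * pi) = u t)"

text \<open>The defining properties of \<open>u\<^sub>1\<close>, \<open>u\<^sub>5\<close> and \<open>u\<^sub>p\<close>. A solution on \<open>[0,\<infinity>)\<close> with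
  \<open>u'(0) = 0\<close> extends to an even solution on the whole line, so using global solutions is no
  restriction.\<close>

definition lower_bounded_solution :: "real \<Rightarrow> real \<Rightarrow> (real \<Rightarrow> real) \<Rightarrow> bool" where
  "lower_bounded_solution \<epsilon> lam u \<longleftrightarrow>
     solves_on \<epsilon> lam UNIV u \<and> deriv u 0 = 0 \<and> bounded (u ` {0..}) \<and>
     (\<forall>t\<ge>0. u t < 0 \<and> 3 * (u t)^2 - lam > 0)"

definition upper_bounded_solution :: "real \<Rightarrow> real \<Rightarrow> (real \<Rightarrow> real) \<Rightarrow> bool" where
  "upper_bounded_solution \<epsilon> lam u \<longleftrightarrow>
     solves_on \<epsilon> lam UNIV u \<and> deriv u 0 = 0 \<and> bounded (u ` {0..}) \<and>
     (\<forall>t\<ge>0. u t > 0 \<and> 3 * (u t)^2 - lam > 0)"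

definition increasing_periodic_solution :: "real \<Rightarrow> real \<Rightarrow> (real \<Rightarrow> real) \<Rightarrow> bool" where
  "increasing_periodic_solution \<epsilon> lam u \<longleftrightarrow>
     periodic_solution \<epsilon> lam u \<and> deriv u 0 = 0 \<and> u (pi/2) = 0 \<and>
     (\<forall>t\<in>{0<..<pi/2}. deriv u t > 0)"

definition is_the_unique :: "('a \<Rightarrow> bool) \<Rightarrow> 'a \<Rightarrow> bool" where
  "is_the_unique P x \<longleftrightarrow> P x \<and> (\<forall>y. P y \<longrightarrow> y = x)"

definition smallest_root :: "real \<Rightarrow> real" where
  "smallest_root lam = Min {u. u^3 - lam * u + 1 = 0}"

end

theory Submission
  imports Defs
begin

text \<open>Even \<open>2\<pi>\<close>-periodic solutions correspond to solutions of the Neumann problem on \<open>[0, \<pi>]\<close>, and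
  these are found by shooting from \<open>t = 0\<close> in the initial value \<open>\<alpha>\<close>: after truncating the right-hand
  side outside a strip bounded by a lower and an upper barrier the flow is global, the intermediate
  value theorem gives \<open>u'(\<pi>) = 0\<close>, and the maximum principle keeps the solution inside the strip, where
  the truncation is invisible. With \<open>s = sqrt (lam / 3)\<close> the strip \<open>[s, b]\<close> yields \<open>u\<^sub>5\<close>; shooting for
  \<open>u(\<pi>/2) = 0\<close> in \<open>[- b, 0]\<close> and reflecting yields \<open>u\<^sub>p\<close>. A Wronskian argument for negative solutions on
  \<open>[0, \<pi>/2]\<close> gives uniqueness of \<open>u\<^sub>p\<close> and shows that the given solution, which crosses \<open>b\<close> early, starts
  above \<open>u\<^sub>p\<close> and stays above it. In the strip between \<open>u\<^sub>p\<close> and \<open>b\<close> that solution therefore has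
  \<open>u'(\<pi>) > 0\<close> after truncation, while initial values slightly below \<open>u\<^sub>5(0)\<close> give \<open>u'(\<pi>) < 0\<close>; in between
  lies \<open>u\<^sub>4\<close>. Finally \<open>u(t) \<mapsto> - u(\<pi> - t)\<close> maps solutions to solutions and turns \<open>u\<^sub>5, u\<^sub>4\<close> into
  \<open>u\<^sub>1, u\<^sub>2\<close>.\<close>

section \<open>Second-order differential inequalities and uniqueness\<close>

lemma mono_within:
  fixes f f' :: "real \<Rightarrow> real"
  assumes "a \<le> c"
    and der: "\<And>t. t \<in> {a..c} \<Longrightarrow> (f has_real_derivative f' t) (at t within {a..c})"
    and pos: "\<And>t. a < t \<Longrightarrow> t < c \<Longrightarrow> f' t \<ge> 0"
  shows "f a \<le> f c"
proof (cases "a = c")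
  case False
  then have ac: "a < c" using assms(1) by simp
  obtain x where x: "x \<in> {a<..<c}" "f c - f a = f' x * (c - a)"
    using mvt_simple[OF ac, of f "\<lambda>t h. f' t * h"] der by (auto simp: has_field_derivative_def)
  have "f' x * (c - a) \<ge> 0" using x pos ac by auto
  then show ?thesis using x by simp
qed simp

text \<open>Turns a meeting of two curves into a first meeting, before which their order is strict;
  comparison arguments apply it to a difference.\<close>

lemma first_zero:
  fixes h :: "real \<Rightarrow> real"
  assumes cont: "continuous_on {a..c} h" and "a \<le> c" "h a < 0" "h c \<ge> 0"
  obtains m where "a < m" "m \<le> c" "h m = 0" "\<And>t. a \<le> t \<Longrightarrow> t < m \<Longrightarrow> h t < 0"
proof -
  let ?S = "{t \<in> {a..c}. h t = 0}"
  have "closed ?S" using continuous_closed_preimage_constant[OF cont closed_atLeastAtMost, of 0] .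
  then have "compact ({a..c} \<inter> ?S)" by (rule compact_Int_closed[OF compact_Icc])
  moreover have "{a..c} \<inter> ?S = ?S" by blast
  ultimately have "compact ?S" by (simp only:)
  moreover have "?S \<noteq> {}" using IVT'[of h a 0 c] assms by force
  ultimately have "\<exists>m\<in>?S. \<forall>t\<in>?S. m \<le> t"
    by (rule continuous_attains_inf[OF _ _ continuous_on_id])
  then obtain m where m: "m \<in> ?S" and least: "\<forall>t\<in>?S. m \<le> t" by (rule bexE)
  show ?thesis
  proof (rule that[of m])
    show "a < m" using m assms by (cases "a = m") auto
    fix t assume t: "a \<le> t" "t < m"
    show "h t < 0"
    proof (rule ccontr)
      assume "\<not> h t < 0"
      moreover have "continuous_on {a..t} h" using cont t m by (auto intro: continuous_on_subset)
      ultimately obtain s where "a \<le> s" "s \<le> t" "h s = 0"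
        using IVT'[of h a 0 t] assms t by force
      moreover have "s \<in> ?S" using calculation t m by simp
      ultimately show False using bspec[OF least, of s] t by simp
    qed
  qed (use m in auto)
qed

text \<open>At a maximum \<open>m\<close> with \<open>d m >= 0\<close>, the condition
  \<open>d2 m > 0\<close> makes \<open>d1\<close> strictly increasing through \<open>m\<close>.
  Maximality then forces \<open>d1 m < 0\<close> unless \<open>m = c\<close>, and
  \<open>d1 m > 0\<close> unless \<open>m = a\<close>. So an interior maximum is impossible, and
  each end is excluded by its Dirichlet or Neumann alternative.\<close>

lemma max_principle:
  fixes d d1 d2 :: "real \<Rightarrow> real"
  assumes "a < c"
    and d: "\<And>t. (d has_real_derivative d1 t) (at t)"
    and d1: "\<And>t. (d1 has_real_derivative d2 t) (at t)"
    and pos: "\<And>t. t \<in> {a..c} \<Longrightarrow> d t \<ge> 0 \<Longrightarrow> d2 t > 0"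
    and left: "d a < 0 \<or> d1 a \<ge> 0" and right: "d c < 0 \<or> d1 c \<le> 0"
    and t: "t \<in> {a..c}"
  shows "d t < 0"
proof (rule ccontr)
  assume "\<not> d t < 0"
  have "continuous_on {a..c} d"
    by (intro continuous_at_imp_continuous_on ballI DERIV_isCont[OF d])
  then obtain m where m: "m \<in> {a..c}" "\<And>x. x \<in> {a..c} \<Longrightarrow> d x \<le> d m"
    using continuous_attains_sup[of "{a..c}" d] \<open>a < c\<close> by auto
  have dm: "d m \<ge> 0" using m(2)[OF t] \<open>\<not> d t < 0\<close> by simp
  then have d2m: "d2 m > 0" using pos m by simp
  have *: "d1 m < 0" if "m < c"
  proof (rule ccontr)
    assume "\<not> d1 m < 0"
    obtain e where e: "e > 0" "\<And>h. h > 0 \<Longrightarrow> h < e \<Longrightarrow> d1 m < d1 (m + h)"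
      using DERIV_pos_inc_right[OF d1 d2m] by blast
    define h where "h = min (e/2) (c - m)"
    have h: "h > 0" "h < e" "m + h \<le> c" using e that by (auto simp: h_def min_def)
    obtain z where "z > m" "z < m + h" "d (m + h) - d m = (m + h - m) * d1 z"
      using MVT2[of m "m + h" d d1] d h by auto
    moreover have "d1 z > 0" using e(2)[of "z - m"] calculation h \<open>\<not> d1 m < 0\<close> by auto
    ultimately have "d (m + h) - d m > 0" using h by simp
    then show False using m(2)[of "m + h"] h m(1) by auto
  qed
  have **: "d1 m > 0" if "m > a"
  proof (rule ccontr)
    assume "\<not> d1 m > 0"
    obtain e where e: "e > 0" "\<And>h. h > 0 \<Longrightarrow> h < e \<Longrightarrow> d1 (m - h) < d1 m"
      using DERIV_pos_inc_left[OF d1 d2m] by blast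
    define h where "h = min (e/2) (m - a)"
    have h: "h > 0" "h < e" "m - h \<ge> a" using e that by (auto simp: h_def min_def)
    obtain z where "z > m - h" "z < m" "d m - d (m - h) = (m - (m - h)) * d1 z"
      using MVT2[of "m - h" m d d1] d h by auto
    moreover have "d1 z < 0" using e(2)[of "m - z"] calculation h \<open>\<not> d1 m > 0\<close> by auto
    ultimately have "d m - d (m - h) < 0" using h by (simp add: mult_less_0_iff)
    then show False using m(2)[of "m - h"] h m(1) by auto
  qed
  consider "a < m" "m < c" | "m = a" | "m = c" using m by fastforce
  then show False
    using * ** left right dm \<open>a < c\<close> by cases auto
qed

text \<open>Follows from the strict version after subtracting the value \<open>d t\<close>, assumed
  positive. It serves differences of two solutions, where the sign of \<open>d2\<close> is known
  only for \<open>d > 0\<close>.\<close>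

lemma max_principle_weak:
  fixes d d1 d2 :: "real \<Rightarrow> real"
  assumes "a < c"
    and d: "\<And>t. (d has_real_derivative d1 t) (at t)"
    and d1: "\<And>t. (d1 has_real_derivative d2 t) (at t)"
    and pos: "\<And>t. t \<in> {a..c} \<Longrightarrow> d t > 0 \<Longrightarrow> d2 t > 0"
    and left: "d a \<le> 0 \<or> d1 a \<ge> 0" and right: "d c \<le> 0 \<or> d1 c \<le> 0"
    and t: "t \<in> {a..c}"
  shows "d t \<le> 0"
proof (rule ccontr)
  assume "\<not> d t \<le> 0"
  moreover have "((\<lambda>s. d s - d t) has_real_derivative d1 s) (at s)" for s
    using d by (auto intro!: derivative_eq_intros)
  ultimately have "d t - d t < 0"
    using max_principle[OF \<open>a < c\<close>, of "\<lambda>s. d s - d t" d1 d2 t] d1 pos left right t by force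
  then show False by simp
qed

text \<open>Shooting form of the maximum principle: \<open>d1 t <= 0\<close> would complete a pair
  of Neumann conditions on \<open>{a..t}\<close> and so force \<open>d a < 0\<close>.\<close>

lemma growth:
  fixes d d1 d2 :: "real \<Rightarrow> real"
  assumes d: "\<And>t. (d has_real_derivative d1 t) (at t)"
    and d1: "\<And>t. (d1 has_real_derivative d2 t) (at t)"
    and pos: "\<And>t. t \<in> {a..c} \<Longrightarrow> d t \<ge> 0 \<Longrightarrow> d2 t > 0"
    and left: "d a \<ge> 0" "d1 a \<ge> 0" and t: "a < t" "t \<le> c"
  shows "d1 t > 0"
proof (rule ccontr)
  assume "\<not> d1 t > 0"
  then have "d a < 0"
    using max_principle[OF t(1) d d1, of a] pos left t by force
  then show False using left by simp
qed

lemma growth_strict: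
  fixes d d1 d2 :: "real \<Rightarrow> real"
  assumes d: "\<And>t. (d has_real_derivative d1 t) (at t)"
    and d1: "\<And>t. (d1 has_real_derivative d2 t) (at t)"
    and pos: "\<And>t. t \<in> {a..c} \<Longrightarrow> d t > 0 \<Longrightarrow> d2 t > 0"
    and left: "d a > 0" "d1 a \<ge> 0" and t: "a < t" "t \<le> c"
  shows "d1 t > 0"
proof (rule ccontr)
  assume "\<not> d1 t > 0"
  then have "d a \<le> 0"
    using max_principle_weak[OF t(1) d d1, of a] pos left t by force
  then show False using left by simp
qed

text \<open>Gronwall argument for the energy \<open>E = d^2 + e^2\<close>: from
  \<open>|E'| <= K * E\<close>, the product \<open>E * exp (- K * t)\<close> is nonincreasing to the
  right of \<open>t0\<close> and \<open>E * exp (K * t)\<close> nondecreasing to its left, and both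
  vanish at \<open>t0\<close>.\<close>

lemma linear_ode_zero:
  fixes d e g :: "real \<Rightarrow> real"
  assumes d: "\<And>t. t \<in> {a..c} \<Longrightarrow> (d has_real_derivative e t) (at t within {a..c})"
    and e: "\<And>t. t \<in> {a..c} \<Longrightarrow> (e has_real_derivative g t) (at t within {a..c})"
    and g: "\<And>t. t \<in> {a..c} \<Longrightarrow> \<bar>g t\<bar> \<le> L * \<bar>d t\<bar>"
    and t0: "t0 \<in> {a..c}" "d t0 = 0" "e t0 = 0" and t: "t \<in> {a..c}"
  shows "d t = 0 \<and> e t = 0"
proof -
  define E where "E t = (d t)^2 + (e t)^2" for t
  define E' where "E' t = 2 * d t * e t + 2 * e t * g t" for t
  define K where "K = 1 + \<bar>L\<bar>"
  have bound: "\<bar>E' t\<bar> \<le> K * E t" if "t \<in> {a..c}" for t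
  proof -
    have "\<bar>e t\<bar> * \<bar>g t\<bar> \<le> \<bar>e t\<bar> * (\<bar>L\<bar> * \<bar>d t\<bar>)"
      using order_trans[OF g[OF that] mult_right_mono[OF abs_ge_self[of L]]] by (intro mult_left_mono) auto
    then have 1: "\<bar>E' t\<bar> \<le> 2 * \<bar>d t\<bar> * \<bar>e t\<bar> + \<bar>L\<bar> * (2 * \<bar>d t\<bar> * \<bar>e t\<bar>)"
      unfolding E'_def
      by (intro order_trans[OF abs_triangle_ineq]) (auto simp: abs_mult algebra_simps)
    have 2: "2 * \<bar>d t\<bar> * \<bar>e t\<bar> \<le> E t"
      using sum_squares_bound[of "\<bar>d t\<bar>" "\<bar>e t\<bar>"] by (simp add: E_def)
    have "\<bar>L\<bar> * (2 * \<bar>d t\<bar> * \<bar>e t\<bar>) \<le> \<bar>L\<bar> * E t"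
      using 2 by (rule mult_left_mono) simp
    then show ?thesis using 1 2 by (simp add: K_def algebra_simps)
  qed
  have dE: "(E has_real_derivative E' t) (at t within {a..c})" if "t \<in> {a..c}" for t
    unfolding E_def E'_def
    by (rule derivative_eq_intros d[OF that] e[OF that] refl)+ (simp add: algebra_simps)
  have "E t = 0"
  proof (cases "t0 \<le> t")
    case True
    have "- (E t0 * exp (- K * t0)) \<le> - (E t * exp (- K * t))"
    proof (rule mono_within[OF True, of _ "\<lambda>s. (K * E s - E' s) * exp (- K * s)"])
      fix s assume s: "s \<in> {t0..t}"
      then have "(E has_real_derivative E' s) (at s within {t0..t})"
        using dE[of s] t0 t by (auto intro: DERIV_subset)
      then show "((\<lambda>s. - (E s * exp (- K * s))) has_real_derivative (K * E s - E' s) * exp (- K * s))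
          (at s within {t0..t})"
        by (auto intro!: derivative_eq_intros simp: algebra_simps)
    next
      fix s assume "t0 < s" "s < t"
      then show "0 \<le> (K * E s - E' s) * exp (- K * s)" using bound[of s] t0 t by auto
    qed
    moreover have "E t0 = 0" using t0 by (simp add: E_def)
    ultimately have "E t \<le> 0" by (simp add: mult_le_0_iff)
    then show ?thesis unfolding E_def by (smt (verit) zero_le_power2)
  next
    case False
    then have le: "t \<le> t0" by simp
    have "E t * exp (K * t) \<le> E t0 * exp (K * t0)"
    proof (rule mono_within[OF le, of _ "\<lambda>s. (K * E s + E' s) * exp (K * s)"])
      fix s assume s: "s \<in> {t..t0}"
      then have "(E has_real_derivative E' s) (at s within {t..t0})"
        using dE[of s] t0 t by (auto intro: DERIV_subset)
      then show "((\<lambda>s. E s * exp (K * s)) has_real_derivative (K * E s + E' s) * exp (K * s))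
          (at s within {t..t0})"
        by (auto intro!: derivative_eq_intros simp: algebra_simps)
    next
      fix s assume "t < s" "s < t0"
      then show "0 \<le> (K * E s + E' s) * exp (K * s)" using bound[of s] t0 t by auto
    qed
    moreover have "E t0 = 0" using t0 by (simp add: E_def)
    ultimately have "E t \<le> 0" by (simp add: mult_le_0_iff)
    then show ?thesis unfolding E_def by (smt (verit) zero_le_power2)
  qed
  then show ?thesis by (simp add: E_def sum_power2_eq_zero_iff)
qed

section \<open>Uniqueness for \<open>u'' = F t u\<close>, written as a first-order system\<close>

definition ode_on :: "real set \<Rightarrow> (real \<Rightarrow> real \<Rightarrow> real) \<Rightarrow> (real \<Rightarrow> real) \<Rightarrow> (real \<Rightarrow> real) \<Rightarrow> bool" where
  "ode_on S F u v \<longleftrightarrow> (\<forall>t\<in>S. (u has_real_derivative v t) (at t within S)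
                        \<and> (v has_real_derivative F t (u t)) (at t within S))"

lemma ode_on_subset: "ode_on S F u v \<Longrightarrow> T \<subseteq> S \<Longrightarrow> ode_on T F u v"
  unfolding ode_on_def by (blast intro: DERIV_subset)

lemma ode_on_cong: "ode_on S F u v \<Longrightarrow> (\<And>t. t \<in> S \<Longrightarrow> F t (u t) = G t (u t)) \<Longrightarrow> ode_on S G u v"
  unfolding ode_on_def by metis

lemma ode_onD:
  assumes "ode_on UNIV F u v"
  shows "(u has_real_derivative v t) (at t)" "(v has_real_derivative F t (u t)) (at t)"
  using assms by (auto simp: ode_on_def)

text \<open>The constant may depend on \<open>r\<close> but not on \<open>t\<close>; this suits the
  cubic, in whose differences the forcing cancels.\<close>

definition locally_lipschitz :: "(real \<Rightarrow> real \<Rightarrow> real) \<Rightarrow> bool" where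
  "locally_lipschitz F \<longleftrightarrow>
     (\<forall>r. \<exists>L. \<forall>t x y. \<bar>x\<bar> \<le> r \<longrightarrow> \<bar>y\<bar> \<le> r \<longrightarrow> \<bar>F t x - F t y\<bar> \<le> L * \<bar>x - y\<bar>)"

text \<open>Both solutions are bounded on the compact interval, so one Lipschitz constant serves
  along both and their difference falls under \<open>linear_ode_zero\<close>.\<close>

lemma ode_on_unique:
  assumes F: "locally_lipschitz F" and u: "ode_on {a..c} F u v" and w: "ode_on {a..c} F w z"
    and t0: "t0 \<in> {a..c}" "u t0 = w t0" "v t0 = z t0" and t: "t \<in> {a..c}"
  shows "u t = w t \<and> v t = z t"
proof -
  have "continuous_on {a..c} u" "continuous_on {a..c} w"
    using u w by (auto simp: ode_on_def intro!: DERIV_continuous_on)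
  then have "bounded (u ` {a..c} \<union> w ` {a..c})"
    by (auto intro!: compact_imp_bounded compact_continuous_image)
  then obtain r where r: "\<forall>x \<in> u ` {a..c} \<union> w ` {a..c}. \<bar>x\<bar> \<le> r"
    unfolding bounded_iff real_norm_def by blast
  obtain L where L: "\<And>t x y. \<bar>x\<bar> \<le> r \<Longrightarrow> \<bar>y\<bar> \<le> r \<Longrightarrow> \<bar>F t x - F t y\<bar> \<le> L * \<bar>x - y\<bar>"
    using F unfolding locally_lipschitz_def by meson
  have "u t - w t = 0 \<and> v t - z t = 0"
  proof (rule linear_ode_zero[of a c "\<lambda>t. u t - w t" "\<lambda>t. v t - z t" "\<lambda>t. F t (u t) - F t (w t)" L t0])
    fix t assume "t \<in> {a..c}"
    then show "((\<lambda>t. u t - w t) has_real_derivative v t - z t) (at t within {a..c})"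
      "((\<lambda>t. v t - z t) has_real_derivative F t (u t) - F t (w t)) (at t within {a..c})"
      using u w by (auto simp: ode_on_def intro!: DERIV_diff)
    show "\<bar>F t (u t) - F t (w t)\<bar> \<le> L * \<bar>u t - w t\<bar>" using r \<open>t \<in> {a..c}\<close> by (intro L) auto
  qed (use t0 t in auto)
  then show ?thesis by simp
qed

lemma ode_unique:
  assumes F: "locally_lipschitz F" and u: "ode_on UNIV F u v" and w: "ode_on UNIV F w z"
    and t0: "u t0 = w t0" "v t0 = z t0"
  shows "u = w \<and> v = z"
proof -
  have "u t = w t \<and> v t = z t" for t
    using ode_on_unique[OF F ode_on_subset[OF u] ode_on_subset[OF w], of "min t t0" "max t t0" t0 t] t0
    by auto
  then show ?thesis by auto
qed

section \<open>Global solutions of Lipschitz equations\<close>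

lemma ex_primitive:
  fixes g :: "real \<Rightarrow> real"
  assumes "continuous_on UNIV g"
  shows "\<exists>A. A 0 = 0 \<and> (\<forall>t. (A has_real_derivative g t) (at t))"
proof -
  obtain A where "\<forall>t. (A has_vector_derivative g t) (at t)"
    using einterval_antiderivative[of "-\<infinity>" "\<infinity>" g] assms by (auto simp: continuous_on_eq_continuous_at)
  then have "((\<lambda>t. A t - A 0) has_real_derivative g t) (at t)" for t
    by (auto simp: has_real_derivative_iff_has_vector_derivative intro!: derivative_eq_intros)
  then show ?thesis by (intro exI[of _ "\<lambda>t. A t - A 0"]) simp
qed

text \<open>Normalised at \<open>0\<close> and defined on the whole line, so that times of both
  signs are treated without oriented integrals.\<close>

definition primitive :: "(real \<Rightarrow> real) \<Rightarrow> real \<Rightarrow> real" where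
  "primitive g = (SOME A. A 0 = 0 \<and> (\<forall>t. (A has_real_derivative g t) (at t)))"

lemma primitive:
  assumes "continuous_on UNIV g"
  shows "primitive g 0 = 0" "(primitive g has_real_derivative g t) (at t)" "continuous_on UNIV (primitive g)"
proof -
  have *: "primitive g 0 = 0 \<and> (\<forall>t. (primitive g has_real_derivative g t) (at t))"
    unfolding primitive_def using ex_primitive[OF assms] by (rule someI_ex)
  then show "primitive g 0 = 0" "(primitive g has_real_derivative g t) (at t)" by auto
  show "continuous_on UNIV (primitive g)" using * by (auto intro!: DERIV_continuous_on[where D=g])
qed

text \<open>Integration from \<open>0\<close> gains a factor \<open>1 / K\<close> against the
  exponential weight, because \<open>C / K * exp (K * t) - A t\<close> has a nonnegative
  derivative.\<close>

lemma exp_growth_bound_nonneg: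
  fixes A g :: "real \<Rightarrow> real"
  assumes A: "A 0 = 0" "\<And>t. (A has_real_derivative g t) (at t)"
    and g: "\<And>t. \<bar>g t\<bar> \<le> C * exp (K * \<bar>t\<bar>)" and "K > 0" "t \<ge> 0"
  shows "A t \<le> C / K * exp (K * \<bar>t\<bar>)"
proof -
  have C: "C \<ge> 0" using g[of 0] by simp
  have "C / K * exp (K * 0) - A 0 \<le> C / K * exp (K * t) - A t"
  proof (rule mono_within[OF \<open>t \<ge> 0\<close>, of _ "\<lambda>s. C * exp (K * s) - g s"])
    fix s
    show "((\<lambda>s. C / K * exp (K * s) - A s) has_real_derivative C * exp (K * s) - g s) (at s within {0..t})"
      using DERIV_subset[OF A(2)[of s], of "{0..t}"] \<open>K > 0\<close> by (auto intro!: derivative_eq_intros)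
    assume "0 < s" then show "0 \<le> C * exp (K * s) - g s" using g[of s] by simp
  qed
  moreover have "C / K \<ge> 0" using C \<open>K > 0\<close> by simp
  ultimately show ?thesis using A \<open>t \<ge> 0\<close> by simp
qed

lemma exp_growth_bound:
  fixes A g :: "real \<Rightarrow> real"
  assumes A: "A 0 = 0" "\<And>t. (A has_real_derivative g t) (at t)"
    and g: "\<And>t. \<bar>g t\<bar> \<le> C * exp (K * \<bar>t\<bar>)" and K: "K > 0"
  shows "\<bar>A t\<bar> \<le> C / K * exp (K * \<bar>t\<bar>)"
proof -
  \<comment> \<open>The one-sided bound is applied to \<open>A\<close>, \<open>- A\<close> and their
    time reflections, which covers both signs of the value and of \<open>t\<close>.\<close>
  have refl: "((\<lambda>s. A (- s)) has_real_derivative - g (- s)) (at s)" for s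
    using A(2)[of "- s"] by (simp only: DERIV_mirror)
  have neg: "((\<lambda>s. - A s) has_real_derivative - g s) (at s)" for s
    using A(2) by (auto intro!: derivative_eq_intros)
  have refl_neg: "((\<lambda>s. - A (- s)) has_real_derivative g (- s)) (at s)" for s
    using refl by (auto intro!: derivative_eq_intros)
  show ?thesis
  proof (cases "t \<ge> 0")
    case True
    then show ?thesis
      using exp_growth_bound_nonneg[of A g C K t] exp_growth_bound_nonneg[of "\<lambda>s. - A s" "\<lambda>s. - g s" C K t]
        A g K neg by simp
  next
    case False
    have g': "\<bar>g (- t)\<bar> \<le> C * exp (K * \<bar>t\<bar>)" for t using g[of "- t"] by simp
    show ?thesis
      using exp_growth_bound_nonneg[OF _ refl _ K, of C "- t"] exp_growth_bound_nonneg[OF _ refl_neg _ K, of C "- t"]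
        A g' False by simp
  qed
qed

lemma second_primitive_bound:
  assumes g: "continuous_on UNIV g" and h: "continuous_on UNIV h"
    and bound: "\<And>t. \<bar>g t - h t\<bar> \<le> C * exp (K * \<bar>t\<bar>)" and K: "K > 0"
  shows "\<bar>primitive (primitive g) t - primitive (primitive h) t\<bar> \<le> C / K\<^sup>2 * exp (K * \<bar>t\<bar>)"
proof -
  have 1: "\<bar>primitive g t - primitive h t\<bar> \<le> C / K * exp (K * \<bar>t\<bar>)" for t
    using primitive[OF g] primitive[OF h]
    by (intro exp_growth_bound[where g = "\<lambda>t. g t - h t"] bound K DERIV_diff) simp_all
  have "\<bar>primitive (primitive g) t - primitive (primitive h) t\<bar> \<le> C / K / K * exp (K * \<bar>t\<bar>)" for t
    using primitive[OF primitive(3)[OF g]] primitive[OF primitive(3)[OF h]]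
    by (intro exp_growth_bound[where g = "\<lambda>t. primitive g t - primitive h t"] 1 K DERIV_diff) simp_all
  then show ?thesis by (simp add: power2_eq_square)
qed

text \<open>The Picard operator for the unknown \<open>exp (- K * \<bar>t\<bar>) * u t\<close> is a contraction of the bounded
  continuous functions on the whole line: two integrations against \<open>exp (K * \<bar>t\<bar>)\<close> gain a factor
  \<open>1 / K\<^sup>2\<close>, so \<open>K\<close> is chosen to make \<open>(\<bar>L\<bar> + 1) / K\<^sup>2 = 1 / 2\<close>. The fixed point depends on \<open>\<alpha>\<close> in a
  Lipschitz way.\<close>

lemma global_flow:
  fixes F :: "real \<Rightarrow> real \<Rightarrow> real"
  assumes cont: "continuous_on UNIV (\<lambda>p. F (fst p) (snd p))"
    and lip: "\<And>t x y. \<bar>F t x - F t y\<bar> \<le> L * \<bar>x - y\<bar>"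
    and bound: "\<And>t. \<bar>F t 0\<bar> \<le> B"
  obtains U V where "\<And>\<alpha>. ode_on UNIV F (U \<alpha>) (V \<alpha>)" "\<And>\<alpha>. U \<alpha> 0 = \<alpha>" "\<And>\<alpha>. V \<alpha> 0 = 0"
    "\<And>c. \<exists>M>0. \<forall>\<alpha> \<beta> t. \<bar>t\<bar> \<le> c \<longrightarrow> \<bar>U \<alpha> t - U \<beta> t\<bar> \<le> M * \<bar>\<alpha> - \<beta>\<bar> \<and> \<bar>V \<alpha> t - V \<beta> t\<bar> \<le> M * \<bar>\<alpha> - \<beta>\<bar>"
proof -
  \<comment> \<open>The summand \<open>1\<close> keeps \<open>K\<close> positive when
    \<open>L = 0\<close>.\<close>
  define K where "K = sqrt (2 * (\<bar>L\<bar> + 1))"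
  have K: "K > 0" "K\<^sup>2 = 2 * (\<bar>L\<bar> + 1)" by (auto simp: K_def)
  have lip': "\<bar>F t x - F t y\<bar> \<le> (\<bar>L\<bar> + 1) * \<bar>x - y\<bar>" for t x y
    using lip[of t x y] by (rule order_trans) (simp add: mult_right_mono)
  define g where "g w s = F s (exp (K * \<bar>s\<bar>) * apply_bcontfun w s)" for w :: "real \<Rightarrow>\<^sub>C real" and s
  define D where "D w = primitive (primitive (g w))" for w
  define \<Phi> where "\<Phi> \<alpha> w = Bcontfun (\<lambda>t. exp (- K * \<bar>t\<bar>) * (\<alpha> + D w t))" for \<alpha> w
  have gcont: "continuous_on UNIV (g w)" for w
  proof -
    have "continuous_on UNIV (\<lambda>s. (\<lambda>p. F (fst p) (snd p)) (s, exp (K * \<bar>s\<bar>) * apply_bcontfun w s))"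
      by (rule continuous_on_compose2[OF cont]) (auto intro!: continuous_intros)
    then show ?thesis by (simp add: g_def[abs_def])
  qed
  have gdiff: "\<bar>g w s - g w' s\<bar> \<le> (\<bar>L\<bar> + 1) * dist w w' * exp (K * \<bar>s\<bar>)" for w w' s
  proof -
    have "\<bar>g w s - g w' s\<bar> \<le> (\<bar>L\<bar> + 1) * (exp (K * \<bar>s\<bar>) * \<bar>apply_bcontfun w s - apply_bcontfun w' s\<bar>)"
      unfolding g_def using lip'[of s "exp (K * \<bar>s\<bar>) * apply_bcontfun w s" "exp (K * \<bar>s\<bar>) * apply_bcontfun w' s"]
      by (simp add: right_diff_distrib[symmetric] abs_mult)
    also have "\<dots> \<le> (\<bar>L\<bar> + 1) * (exp (K * \<bar>s\<bar>) * dist w w')"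
      using dist_bounded[of w s w'] by (intro mult_left_mono) (auto simp: dist_real_def)
    finally show ?thesis by (simp add: mult_ac)
  qed
  have Dcont: "continuous_on UNIV (D w)" for w
    unfolding D_def by (intro primitive gcont)
  have Ddiff: "\<bar>D w t - D w' t\<bar> \<le> 1/2 * dist w w' * exp (K * \<bar>t\<bar>)" for w w' t
  proof -
    have "(\<bar>L\<bar> + 1) * dist w w' / K\<^sup>2 = 1/2 * dist w w'"
      unfolding K(2) by (simp add: divide_simps add_nonneg_eq_0_iff)
    then show ?thesis
      using second_primitive_bound[OF gcont gcont gdiff K(1), of w t w'] unfolding D_def by (simp only:)
  qed
  have g0: "\<bar>g 0 t - 0\<bar> \<le> \<bar>B\<bar> * exp (K * \<bar>t\<bar>)" for t
  proof -
    have "\<bar>g 0 t\<bar> \<le> \<bar>B\<bar> * 1" using bound[of t] by (simp add: g_def)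
    also have "\<dots> \<le> \<bar>B\<bar> * exp (K * \<bar>t\<bar>)" using K by (intro mult_left_mono) auto
    finally show ?thesis by simp
  qed
  \<comment> \<open>With \<open>h\<close> the zero function, \<open>second_primitive_bound\<close>
    bounds \<open>D 0\<close> itself; every other \<open>D w\<close> is then controlled through its
    distance to \<open>D 0\<close>.\<close>
  have 0: "primitive (primitive (\<lambda>_. 0)) t = 0" for t
  proof -
    have p: "primitive (\<lambda>_. 0) t = 0" for t
      using exp_growth_bound[of "primitive (\<lambda>_. 0)" "\<lambda>_. 0" 0 1 t] primitive[of "\<lambda>_. 0"] by simp
    then have "primitive (\<lambda>_. 0) = (\<lambda>_. 0)" by auto
    then show ?thesis using p by simp
  qed
  have D0: "\<bar>D 0 t\<bar> \<le> \<bar>B\<bar> / K\<^sup>2 * exp (K * \<bar>t\<bar>)" for t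
    using second_primitive_bound[OF gcont _ g0 K(1), of t] 0 by (simp add: D_def)
  have mem: "(\<lambda>t. exp (- K * \<bar>t\<bar>) * (\<alpha> + D w t)) \<in> bcontfun" for \<alpha> w
  proof (rule bcontfun_normI)
    show "continuous_on UNIV (\<lambda>t. exp (- K * \<bar>t\<bar>) * (\<alpha> + D w t))"
      by (intro continuous_intros Dcont)
    fix t
    have "\<bar>\<alpha> + D w t\<bar> \<le> \<bar>\<alpha>\<bar> + (\<bar>D w t - D 0 t\<bar> + \<bar>D 0 t\<bar>)" by linarith
    also have "\<dots> \<le> \<bar>\<alpha>\<bar> * exp (K * \<bar>t\<bar>) + (1/2 * dist w 0 * exp (K * \<bar>t\<bar>) + \<bar>B\<bar> / K\<^sup>2 * exp (K * \<bar>t\<bar>))"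
      using Ddiff[of w t 0] D0[of t] K mult_left_mono[of 1 "exp (K * \<bar>t\<bar>)" "\<bar>\<alpha>\<bar>"] by (intro add_mono) auto
    also have "\<dots> = (\<bar>\<alpha>\<bar> + 1/2 * dist w 0 + \<bar>B\<bar> / K\<^sup>2) * exp (K * \<bar>t\<bar>)" by (simp add: algebra_simps)
    finally have "exp (- K * \<bar>t\<bar>) * \<bar>\<alpha> + D w t\<bar> \<le>
        exp (- K * \<bar>t\<bar>) * ((\<bar>\<alpha>\<bar> + 1/2 * dist w 0 + \<bar>B\<bar> / K\<^sup>2) * exp (K * \<bar>t\<bar>))"
      by (rule mult_left_mono) simp
    then show "norm (exp (- K * \<bar>t\<bar>) * (\<alpha> + D w t)) \<le> \<bar>\<alpha>\<bar> + 1/2 * dist w 0 + \<bar>B\<bar> / K\<^sup>2"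
      by (simp add: abs_mult exp_minus field_simps)
  qed
  have \<Phi>: "apply_bcontfun (\<Phi> \<alpha> w) t = exp (- K * \<bar>t\<bar>) * (\<alpha> + D w t)" for \<alpha> w t
    unfolding \<Phi>_def Bcontfun_inverse[OF mem] ..
  have \<Phi>lip: "dist (\<Phi> \<alpha> w) (\<Phi> \<beta> w') \<le> \<bar>\<alpha> - \<beta>\<bar> + 1/2 * dist w w'" for \<alpha> \<beta> w w'
  proof (rule dist_bound)
    fix t
    have "\<bar>\<alpha> - \<beta>\<bar> \<le> \<bar>\<alpha> - \<beta>\<bar> * exp (K * \<bar>t\<bar>)"
      using K mult_left_mono[of 1 "exp (K * \<bar>t\<bar>)" "\<bar>\<alpha> - \<beta>\<bar>"] by auto
    then have "\<bar>(\<alpha> + D w t) - (\<beta> + D w' t)\<bar> \<le> \<bar>\<alpha> - \<beta>\<bar> * exp (K * \<bar>t\<bar>) + 1/2 * dist w w' * exp (K * \<bar>t\<bar>)"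
      using Ddiff[of w t w'] by linarith
    then have "exp (- K * \<bar>t\<bar>) * \<bar>(\<alpha> + D w t) - (\<beta> + D w' t)\<bar> \<le>
       exp (- K * \<bar>t\<bar>) * ((\<bar>\<alpha> - \<beta>\<bar> + 1/2 * dist w w') * exp (K * \<bar>t\<bar>))"
      by (intro mult_left_mono) (auto simp: algebra_simps)
    also have "\<dots> = \<bar>\<alpha> - \<beta>\<bar> + 1/2 * dist w w'" by (simp add: exp_minus)
    finally show "dist (apply_bcontfun (\<Phi> \<alpha> w) t) (apply_bcontfun (\<Phi> \<beta> w') t) \<le> \<bar>\<alpha> - \<beta>\<bar> + 1/2 * dist w w'"
      unfolding \<Phi> dist_real_def by (simp add: right_diff_distrib[symmetric] abs_mult)
  qed
  have "\<exists>!w. \<Phi> \<alpha> w = w" for \<alpha>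
    by (rule banach_fix_type[of "1/2"]) (use \<Phi>lip[of \<alpha> _ \<alpha>] in auto)
  then obtain W where W: "\<Phi> \<alpha> (W \<alpha>) = W \<alpha>" for \<alpha> by metis
  define U where "U \<alpha> t = \<alpha> + D (W \<alpha>) t" for \<alpha> t
  define V where "V \<alpha> = primitive (g (W \<alpha>))" for \<alpha>
  have U: "U \<alpha> t = exp (K * \<bar>t\<bar>) * apply_bcontfun (W \<alpha>) t" for \<alpha> t
    using \<Phi>[of \<alpha> "W \<alpha>" t] unfolding W U_def by (simp add: exp_minus)
  have gU: "g (W \<alpha>) t = F t (U \<alpha> t)" for \<alpha> t unfolding U g_def ..
  have U': "(U \<alpha> has_real_derivative V \<alpha> t) (at t)" for \<alpha> t
    using primitive(2)[OF primitive(3)[OF gcont[of "W \<alpha>"]], of t] unfolding U_def D_def V_def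
    by (auto intro!: derivative_eq_intros)
  have V': "(V \<alpha> has_real_derivative F t (U \<alpha> t)) (at t)" for \<alpha> t
    using primitive(2)[OF gcont[of "W \<alpha>"], of t] unfolding gU V_def .
  have V0: "V \<alpha> 0 = 0" for \<alpha> unfolding V_def by (intro primitive gcont)
  \<comment> \<open>For fixed points the term \<open>1/2 * dist\<close> is absorbed on the left,
    which produces the constant \<open>2\<close>.\<close>
  have Wlip: "dist (W \<alpha>) (W \<beta>) \<le> 2 * \<bar>\<alpha> - \<beta>\<bar>" for \<alpha> \<beta>
    using \<Phi>lip[of \<alpha> "W \<alpha>" \<beta> "W \<beta>"] by (simp add: W)
  have Ulip: "\<bar>U \<alpha> t - U \<beta> t\<bar> \<le> 2 * \<bar>\<alpha> - \<beta>\<bar> * exp (K * \<bar>t\<bar>)" for \<alpha> \<beta> t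
  proof -
    have "\<bar>U \<alpha> t - U \<beta> t\<bar> = exp (K * \<bar>t\<bar>) * dist (apply_bcontfun (W \<alpha>) t) (apply_bcontfun (W \<beta>) t)"
      unfolding U dist_real_def by (simp add: right_diff_distrib[symmetric] abs_mult)
    also have "\<dots> \<le> exp (K * \<bar>t\<bar>) * (2 * \<bar>\<alpha> - \<beta>\<bar>)"
      by (intro mult_left_mono order_trans[OF dist_bounded Wlip]) simp
    finally show ?thesis by (simp add: mult_ac)
  qed
  have Vlip: "\<bar>V \<alpha> t - V \<beta> t\<bar> \<le> (2 * (\<bar>L\<bar> + 1) * \<bar>\<alpha> - \<beta>\<bar>) / K * exp (K * \<bar>t\<bar>)" for \<alpha> \<beta> t
  proof (rule exp_growth_bound[where g = "\<lambda>t. F t (U \<alpha> t) - F t (U \<beta> t)"])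
    fix t
    have "\<bar>F t (U \<alpha> t) - F t (U \<beta> t)\<bar> \<le> (\<bar>L\<bar> + 1) * \<bar>U \<alpha> t - U \<beta> t\<bar>" by (rule lip')
    also have "\<dots> \<le> (\<bar>L\<bar> + 1) * (2 * \<bar>\<alpha> - \<beta>\<bar> * exp (K * \<bar>t\<bar>))" by (intro mult_left_mono Ulip) simp
    finally show "\<bar>F t (U \<alpha> t) - F t (U \<beta> t)\<bar> \<le> 2 * (\<bar>L\<bar> + 1) * \<bar>\<alpha> - \<beta>\<bar> * exp (K * \<bar>t\<bar>)"
      by (simp add: algebra_simps)
  qed (use V0 K V' in \<open>auto intro!: DERIV_diff\<close>)
  show ?thesis
  proof (rule that[of U V])
    show "ode_on UNIV F (U \<alpha>) (V \<alpha>)" for \<alpha> using U' V' by (simp add: ode_on_def)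
    show "U \<alpha> 0 = \<alpha>" for \<alpha> using primitive(1)[OF primitive(3)[OF gcont]] by (simp add: U_def D_def)
    show "V \<alpha> 0 = 0" for \<alpha> by (rule V0)
    fix c
    \<comment> \<open>The sum of the constants in \<open>Ulip\<close> and \<open>Vlip\<close> at the
      largest weight on the time range, so that one \<open>M\<close> serves both components.\<close>
    define M where "M = (2 + 2 * (\<bar>L\<bar> + 1) / K) * exp (K * \<bar>c\<bar>)"
    have "M > 0" using K by (auto simp: M_def intro!: mult_pos_pos add_pos_nonneg)
    moreover have "\<bar>U \<alpha> t - U \<beta> t\<bar> \<le> M * \<bar>\<alpha> - \<beta>\<bar> \<and> \<bar>V \<alpha> t - V \<beta> t\<bar> \<le> M * \<bar>\<alpha> - \<beta>\<bar>" if "\<bar>t\<bar> \<le> c" for \<alpha> \<beta> t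
    proof -
      have e: "exp (K * \<bar>t\<bar>) \<le> exp (K * \<bar>c\<bar>)" using that K by simp
      have "2 * \<bar>\<alpha> - \<beta>\<bar> * exp (K * \<bar>t\<bar>) \<le> 2 * \<bar>\<alpha> - \<beta>\<bar> * exp (K * \<bar>c\<bar>)"
        using e by (intro mult_left_mono) auto
      moreover have "(2 * (\<bar>L\<bar> + 1) * \<bar>\<alpha> - \<beta>\<bar>) / K * exp (K * \<bar>t\<bar>) \<le> (2 * (\<bar>L\<bar> + 1) * \<bar>\<alpha> - \<beta>\<bar>) / K * exp (K * \<bar>c\<bar>)"
        using e K by (intro mult_left_mono) auto
      moreover have "2 * \<bar>\<alpha> - \<beta>\<bar> * exp (K * \<bar>c\<bar>) \<ge> 0" "(2 * (\<bar>L\<bar> + 1) * \<bar>\<alpha> - \<beta>\<bar>) / K * exp (K * \<bar>c\<bar>) \<ge> 0"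
        using K by auto
      moreover have "M * \<bar>\<alpha> - \<beta>\<bar> = 2 * \<bar>\<alpha> - \<beta>\<bar> * exp (K * \<bar>c\<bar>) + (2 * (\<bar>L\<bar> + 1) * \<bar>\<alpha> - \<beta>\<bar>) / K * exp (K * \<bar>c\<bar>)"
        by (simp add: M_def algebra_simps add_divide_distrib)
      ultimately show ?thesis using Ulip[of \<alpha> t \<beta>] Vlip[of \<alpha> t \<beta>] by linarith
    qed
    ultimately show "\<exists>M>0. \<forall>\<alpha> \<beta> t. \<bar>t\<bar> \<le> c \<longrightarrow> \<bar>U \<alpha> t - U \<beta> t\<bar> \<le> M * \<bar>\<alpha> - \<beta>\<bar> \<and> \<bar>V \<alpha> t - V \<beta> t\<bar> \<le> M * \<bar>\<alpha> - \<beta>\<bar>"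
      by blast
  qed
qed

section \<open>Reflections and bounded solutions\<close>

lemma has_derivative_reflect:
  fixes f :: "real \<Rightarrow> real"
  assumes "(f has_real_derivative D) (at (c - t))"
  shows "((\<lambda>t. f (c - t)) has_real_derivative - D) (at t)"
proof -
  have "((\<lambda>t. c - t) has_real_derivative - 1) (at t)" by (auto intro!: derivative_eq_intros)
  from DERIV_chain2[of f D "\<lambda>t. c - t" t "-1" UNIV, OF assms this] show ?thesis by simp
qed

lemma ode_on_reflect:
  assumes u: "ode_on UNIV F u v" and F: "\<And>t x. F (c - t) x = F t x"
  shows "ode_on UNIV F (\<lambda>t. u (c - t)) (\<lambda>t. - v (c - t))"
proof -
  have "F (c - t) (u (c - t)) = F t (u (c - t))" for t by (rule F)
  then show ?thesis
    using has_derivative_reflect[OF ode_onD(1)[OF u], of c] DERIV_minus[OF has_derivative_reflect[OF ode_onD(2)[OF u], of c]]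
    by (simp add: ode_on_def)
qed

lemma ode_on_antireflect:
  assumes u: "ode_on UNIV F u v" and F: "\<And>t x. F (c - t) (- x) = - F t x"
  shows "ode_on UNIV F (\<lambda>t. - u (c - t)) (\<lambda>t. v (c - t))"
proof -
  have "- F (c - t) (u (c - t)) = F t (- u (c - t))" for t using F[of t "- u (c - t)"] by simp
  then show ?thesis
    using DERIV_minus[OF has_derivative_reflect[OF ode_onD(1)[OF u], of c]] has_derivative_reflect[OF ode_onD(2)[OF u], of c]
    by (simp add: ode_on_def)
qed

text \<open>At a touching point \<open>w - u\<close> has a minimum, so the velocities agree too and
  uniqueness applies. This upgrades weak order to strict order.\<close>

lemma ode_touching_eq:
  assumes F: "locally_lipschitz F" and u: "ode_on UNIV F u v" and w: "ode_on UNIV F w z"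
    and le: "\<And>t. u t \<le> w t" and eq: "u t0 = w t0"
  shows "u = w"
proof -
  have "((\<lambda>t. w t - u t) has_real_derivative z t0 - v t0) (at t0)"
    using ode_onD[OF u] ode_onD[OF w] by (auto intro!: DERIV_diff)
  then have "z t0 - v t0 = 0"
    by (rule DERIV_local_min[of _ _ _ 1]) (use le eq in auto)
  then show ?thesis using ode_unique[OF F u w eq] by simp
qed

text \<open>\<open>{0..pi}\<close> is a fundamental domain for the group generated by the
  reflections at \<open>0\<close> and \<open>pi\<close>. The point \<open>s\<close> does not depend
  on \<open>u\<close>, so several symmetric functions can be compared at the same point.\<close>

lemma reduce_to_half_period:
  fixes t :: real
  obtains s where "s \<in> {0..pi}"
    "\<And>u :: real \<Rightarrow> real. (\<And>t. u (- t) = u t) \<Longrightarrow> (\<And>t. u (2 * pi - t) = u t) \<Longrightarrow> u t = u s"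
proof (rule that[of "arccos (cos t)"])
  show "arccos (cos t) \<in> {0..pi}" by (auto intro: arccos_lbound arccos_ubound)
  fix u :: "real \<Rightarrow> real"
  assume even: "\<And>t. u (- t) = u t" and sym: "\<And>t. u (2 * pi - t) = u t"
  have "u (t + 2 * pi) = u t" for t using sym[of "- t"] even[of t] by (simp add: add.commute)
  then interpret periodic_fun_simple u "2 * pi" by unfold_locales
  have "cos t = cos (arccos (cos t))" by simp
  then obtain n where n: "n \<in> \<int>" "t = arccos (cos t) + n * 2 * pi \<or> t = - arccos (cos t) + n * 2 * pi"
    using cos_eq[of t "arccos (cos t)"] by (auto simp: algebra_simps)
  then obtain k where k: "n = of_int k" by (auto elim: Ints_cases)
  show "u t = u (arccos (cos t))"
    using n(2) plus_of_int[of "arccos (cos t)" k] plus_of_int[of "- arccos (cos t)" k] even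
    by (metis k mult.assoc)
qed

text \<open>If \<open>u\<close> started above \<open>w\<close>, the difference would stay positive
  and be convex, hence grow at least linearly, against boundedness.\<close>

lemma bounded_solution_le:
  assumes u: "ode_on UNIV F u v" "v 0 = 0" "bounded (u ` {0..})"
    and w: "ode_on UNIV F w z" "z 0 = 0" "bounded (w ` {0..})"
    and mono: "\<And>t. t \<ge> 0 \<Longrightarrow> w t < u t \<Longrightarrow> F t (w t) < F t (u t)"
  shows "u 0 \<le> w 0"
proof (rule ccontr)
  assume "\<not> u 0 \<le> w 0"
  define d where "d t = u t - w t" for t
  define d1 where "d1 t = v t - z t" for t
  have d: "(d has_real_derivative d1 t) (at t)" for t
    unfolding d_def d1_def by (intro DERIV_diff ode_onD[OF u(1)] ode_onD[OF w(1)])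
  have d1: "(d1 has_real_derivative F t (u t) - F t (w t)) (at t)" for t
    unfolding d1_def by (intro DERIV_diff ode_onD[OF u(1)] ode_onD[OF w(1)])
  have pos: "F t (u t) - F t (w t) > 0" if "t \<ge> 0" "d t > 0" for t using mono that by (simp add: d_def)
  have d0: "d 0 > 0" "d1 0 \<ge> 0" using \<open>\<not> u 0 \<le> w 0\<close> u w by (auto simp: d_def d1_def)
  have d1_pos: "d1 t > 0" if "t > 0" for t
    using growth_strict[OF d d1, of 0 t t] pos d0 that by auto
  have d_pos: "d t > 0" if "t \<ge> 0" for t
    using mono_within[OF that, of d d1] DERIV_subset[OF d] d1_pos d0 by (force simp: less_imp_le)
  \<comment> \<open>The difference starts with slope \<open>0\<close>; a positive slope is available
    only at a later time, here \<open>1\<close>.\<close>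
  have d1_ge: "d1 t \<ge> d1 1" if "t \<ge> 1" for t
    by (rule mono_within[OF that, of d1 "\<lambda>t. F t (u t) - F t (w t)"])
      (use DERIV_subset[OF d1] pos d_pos in \<open>auto simp: less_imp_le\<close>)
  have d_ge: "d t \<ge> d1 1 * (t - 1)" if "t \<ge> 1" for t
  proof -
    have "d 1 - d1 1 * 1 \<le> d t - d1 1 * t"
    proof (rule mono_within[OF that, of _ "\<lambda>t. d1 t - d1 1"])
      show "((\<lambda>t. d t - d1 1 * t) has_real_derivative d1 s - d1 1) (at s within {1..t})" for s
        using DERIV_subset[OF d] by (auto intro!: derivative_eq_intros)
    qed (use d1_ge in auto)
    then show ?thesis using d_pos[of 1] by (simp add: algebra_simps)
  qed
  obtain r where r: "\<And>t. t \<ge> 0 \<Longrightarrow> \<bar>u t\<bar> \<le> r" using u(3) by (auto simp: bounded_iff)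
  obtain r' where r': "\<And>t. t \<ge> 0 \<Longrightarrow> \<bar>w t\<bar> \<le> r'" using w(3) by (auto simp: bounded_iff)
  \<comment> \<open>Chosen so that the linear lower bound for \<open>d t\<close> equals
    \<open>|r| + |r'| + 1\<close>, more than two functions bounded by \<open>r\<close> and
    \<open>r'\<close> can differ.\<close>
  define t where "t = 1 + (\<bar>r\<bar> + \<bar>r'\<bar> + 1) / d1 1"
  have "t \<ge> 1" "d1 1 * (t - 1) = \<bar>r\<bar> + \<bar>r'\<bar> + 1" using d1_pos[of 1] by (auto simp: t_def)
  then show False using d_ge[of t] r[of t] r'[of t] by (auto simp: d_def)
qed

lemma bounded_solution_unique:
  assumes F: "locally_lipschitz F"
    and u: "ode_on UNIV F u v" "v 0 = 0" "bounded (u ` {0..})"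
    and w: "ode_on UNIV F w z" "z 0 = 0" "bounded (w ` {0..})"
    and "\<And>t. t \<ge> 0 \<Longrightarrow> w t < u t \<Longrightarrow> F t (w t) < F t (u t)"
    and "\<And>t. t \<ge> 0 \<Longrightarrow> u t < w t \<Longrightarrow> F t (u t) < F t (w t)"
  shows "u = w"
proof -
  have "u 0 = w 0" using bounded_solution_le[OF u w] bounded_solution_le[OF w u] assms by force
  then show ?thesis using ode_unique[OF F u(1) w(1), of 0] u w by simp
qed

section \<open>The truncated equation and the Neumann problem\<close>

locale forced_duffing =
  fixes \<epsilon> lam b :: real
  assumes eps: "\<epsilon> > 0" and b: "b > 0" "b^3 - lam * b - 1 > 0" and lam: "lam > 3 / 2 powr (2/3)"
begin

definition rhs :: "real \<Rightarrow> real \<Rightarrow> real" where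
  "rhs t x = (x^3 - lam * x + cos t) / \<epsilon>^2"

text \<open>The positive critical point of \<open>x^3 - lam * x\<close>, where the cubic has its
  local minimum \<open>- 2 * s^3\<close>.\<close>

definition s :: real where "s = sqrt (lam / 3)"

text \<open>The threshold on \<open>lam\<close> is exactly the one beyond which the local minimum
  \<open>- 2 * s^3\<close> lies below \<open>- 1\<close>, so that adding \<open>cos t\<close> cannot
  lift it to zero.\<close>

lemma s: "s > 0" "lam = 3 * s^2" "2 * s^3 > 1" "s < b"
proof -
  have l: "lam / 3 > 1 / 2 powr (2/3)" using lam by (simp add: field_simps)
  moreover have p: "1 / 2 powr (2/3) > (0::real)" by simp
  ultimately have l0: "lam / 3 > 0" by (rule order.strict_trans[rotated])
  then show s0: "s > 0" by (simp add: s_def)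
  show s2: "lam = 3 * s^2" using l0 by (simp add: s_def)
  have "(1 / 2 powr (2/3))^3 = (1/4 :: real)"
    by (simp add: power_divide powr_realpow[symmetric] powr_powr)
  moreover have "(1 / 2 powr (2/3))^3 < (s^2)^3"
    using l p s2 by (intro power_strict_mono) auto
  ultimately have "(1/2)^2 < (s^3)^2" by (simp add: power2_eq_square power3_eq_cube)
  then have "1/2 < s^3" by (rule power_less_imp_less_base) (use s0 in simp)
  then show "2 * s^3 > 1" by simp
  show "s < b"
  proof (rule ccontr)
    assume "\<not> s < b"
    then have "b^2 \<le> s^2" using b by (intro power_mono) auto
    then have "b^2 \<le> 3 * s^2" using zero_le_power2[of s] by linarith
    then have "b * b^2 \<le> b * lam" unfolding s2[symmetric] using b by (intro mult_left_mono) auto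
    moreover have "b * b^2 = b^3" by (simp add: power2_eq_square power3_eq_cube)
    ultimately show False using b(2) mult.commute[of b lam] by linarith
  qed
qed

lemma lam_pos: "lam > 0"
  using s(2) zero_less_power[OF s(1), of 2] by linarith

text \<open>For the Neumann problem these signs make the constant \<open>b\<close> an upper barrier
  and the constants \<open>- b\<close> and \<open>s\<close> lower barriers.\<close>

lemma rhs_signs: "rhs t b > 0" "rhs t (- b) < 0" "rhs t s < 0"
proof -
  show "rhs t b > 0"
    unfolding rhs_def using b eps cos_ge_minus_one[of t] by (intro divide_pos_pos) (auto simp del: cos_ge_minus_one)
  show "rhs t (- b) < 0"
    unfolding rhs_def using b eps cos_le_one[of t]
    by (intro divide_neg_pos) (auto simp: power3_eq_cube simp del: cos_le_one)
  have "lam * s = 3 * s^3"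
    using arg_cong[OF s(2), of "\<lambda>x. x * s"] by (simp add: power2_eq_square power3_eq_cube)
  then have "s^3 - lam * s + cos t < 0" using s(3) cos_le_one[of t] by linarith
  then show "rhs t s < 0" unfolding rhs_def using eps by (intro divide_neg_pos) auto
qed

lemma rhs_diff: "rhs t x - rhs t y = (x - y) * (x^2 + x * y + y^2 - lam) / \<epsilon>^2"
  by (simp add: rhs_def diff_divide_distrib[symmetric] power2_eq_square power3_eq_cube algebra_simps)

text \<open>For two points on the same side outside \<open>(- s, s)\<close> the quadratic factor in
  \<open>rhs_diff\<close> exceeds \<open>3 * s^2 = lam\<close>.\<close>

lemma rhs_strict_mono:
  assumes "x < y" "s \<le> x \<or> y \<le> - s"
  shows "rhs t x < rhs t y"
proof -
  have "s^2 + s * s + s^2 < y^2 + y * x + x^2"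
    using assms(2)
  proof
    assume "s \<le> x"
    then have "s^2 < y^2" "s * s \<le> y * x" "s^2 \<le> x^2"
      using assms(1) s(1) by (auto intro!: power_strict_mono power_mono mult_mono)
    then show ?thesis by linarith
  next
    assume "y \<le> - s"
    then have "s^2 \<le> (- y)^2" "s * s \<le> (- y) * (- x)" "s^2 < (- x)^2"
      using assms(1) s(1) by (intro power_strict_mono power_mono mult_mono; simp)+
    then show ?thesis by (simp only: power2_minus minus_mult_minus)
  qed
  then have "y^2 + y * x + x^2 - lam > 0" using s(2) unfolding power2_eq_square by linarith
  then have "rhs t y - rhs t x > 0"
    unfolding rhs_diff using assms eps by simp
  then show ?thesis by simp
qed

lemma rhs_lipschitz:
  assumes "\<bar>x\<bar> \<le> r" "\<bar>y\<bar> \<le> r"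
  shows "\<bar>rhs t x - rhs t y\<bar> \<le> (3 * r^2 + lam) / \<epsilon>^2 * \<bar>x - y\<bar>"
proof -
  have "\<bar>x^2\<bar> \<le> r^2" "\<bar>y^2\<bar> \<le> r^2" "\<bar>x * y\<bar> \<le> r * r"
    using assms by (auto simp: abs_mult intro!: mult_mono abs_le_square_iff[THEN iffD1])
  moreover note lam_pos
  ultimately have "\<bar>x^2 + x * y + y^2 - lam\<bar> \<le> 3 * r^2 + lam"
    using zero_le_power2[of x] zero_le_power2[of y] zero_le_power2[of r] unfolding power2_eq_square by linarith
  then have "\<bar>x - y\<bar> * \<bar>x^2 + x * y + y^2 - lam\<bar> / \<epsilon>^2 \<le> \<bar>x - y\<bar> * (3 * r^2 + lam) / \<epsilon>^2"
    by (intro divide_right_mono mult_left_mono) auto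
  then show ?thesis unfolding rhs_diff by (simp add: abs_mult mult.commute)
qed

lemma locally_lipschitz_rhs: "locally_lipschitz rhs"
  unfolding locally_lipschitz_def using rhs_lipschitz by blast

lemma solves_on_iff: "solves_on \<epsilon> lam S u \<longleftrightarrow> (\<exists>v. ode_on S rhs u v)"
proof
  assume "solves_on \<epsilon> lam S u"
  then obtain u' u'' where *: "\<forall>t\<in>S. (u has_real_derivative u' t) (at t within S)
                  \<and> (u' has_real_derivative u'' t) (at t within S)
                  \<and> \<epsilon>^2 * u'' t = (u t)^3 - lam * u t + cos t"
    unfolding solves_on_def by blast
  have "u'' t = rhs t (u t)" if "t \<in> S" for t
    using * that eps by (auto simp: rhs_def nonzero_eq_divide_eq mult.commute)
  then show "\<exists>v. ode_on S rhs u v" unfolding ode_on_def using * by metis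
next
  assume "\<exists>v. ode_on S rhs u v"
  then obtain v where "ode_on S rhs u v" by blast
  then show "solves_on \<epsilon> lam S u"
    unfolding solves_on_def ode_on_def using eps
    by (intro exI[of _ v] exI[of _ "\<lambda>t. rhs t (u t)"]) (auto simp: rhs_def)
qed

section \<open>Truncation outside a strip and the truncated flow\<close>

definition clip :: "real \<Rightarrow> real \<Rightarrow> real \<Rightarrow> real" where
  "clip l h x = max l (min h x)"

text \<open>Outside the strip between \<open>l\<close> and \<open>h\<close> the term \<open>x - clip l h x\<close> makes the truncated right-hand
  side globally Lipschitz while pushing solutions away from the strip, so that solutions of the
  boundary value problem cannot leave it.\<close>

definition trunc :: "(real \<Rightarrow> real) \<Rightarrow> real \<Rightarrow> real \<Rightarrow> real \<Rightarrow> real" where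
  "trunc l h t x = rhs t (clip (l t) h x) + (x - clip (l t) h x)"

lemma trunc_inside: "l t \<le> x \<Longrightarrow> x \<le> h \<Longrightarrow> trunc l h t x = rhs t x"
  by (simp add: trunc_def clip_def)

lemma trunc_above: "l t \<le> h \<Longrightarrow> h \<le> x \<Longrightarrow> trunc l h t x = rhs t h + (x - h)"
  by (simp add: trunc_def clip_def)

lemma trunc_below: "l t \<le> h \<Longrightarrow> x \<le> l t \<Longrightarrow> trunc l h t x = rhs t (l t) + (x - l t)"
  by (simp add: trunc_def clip_def)

text \<open>Clipped values of points above \<open>s\<close> stay above \<open>s\<close> whatever
  \<open>l\<close> is. Hence both summands of \<open>trunc\<close> are monotone there, the first
  strictly if the clipped values differ and the second strictly if they agree.\<close>

lemma trunc_strict_mono: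
  assumes "s \<le> x" "x < y"
  shows "trunc l b t x < trunc l b t y"
proof -
  have c: "s \<le> clip (l t) b x" "clip (l t) b x \<le> clip (l t) b y" "x - clip (l t) b x \<le> y - clip (l t) b y"
    using assms s by (auto simp: clip_def)
  show ?thesis
  proof (cases "clip (l t) b x = clip (l t) b y")
    case True then show ?thesis using assms by (simp add: trunc_def)
  next
    case False
    then have "rhs t (clip (l t) b x) < rhs t (clip (l t) b y)" using c by (intro rhs_strict_mono) auto
    then show ?thesis using c by (simp add: trunc_def)
  qed
qed

lemma trunc_lipschitz:
  assumes "\<And>t. \<bar>l t\<bar> \<le> b" "\<bar>h\<bar> \<le> b"
  shows "\<bar>trunc l h t x - trunc l h t y\<bar> \<le> ((3 * b^2 + lam) / \<epsilon>^2 + 2) * \<bar>x - y\<bar>"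
proof -
  let ?c = "clip (l t) h" and ?k = "(3 * b^2 + lam) / \<epsilon>^2"
  have c: "\<bar>?c x\<bar> \<le> b" "\<bar>?c y\<bar> \<le> b" "\<bar>?c x - ?c y\<bar> \<le> \<bar>x - y\<bar>"
    using assms(1)[of t] assms(2) by (auto simp: clip_def)
  have k: "?k \<ge> 0" using lam_pos by (intro divide_nonneg_nonneg) auto
  have "\<bar>rhs t (?c x) - rhs t (?c y)\<bar> \<le> ?k * \<bar>x - y\<bar>"
    using rhs_lipschitz[OF c(1,2)] mult_left_mono[OF c(3) k] by (rule order_trans)
  moreover have "\<bar>(x - ?c x) - (y - ?c y)\<bar> \<le> 2 * \<bar>x - y\<bar>"
  proof -
    have "\<bar>(x - ?c x) - (y - ?c y)\<bar> = \<bar>(x - y) - (?c x - ?c y)\<bar>" by (simp add: algebra_simps)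
    also have "\<dots> \<le> \<bar>x - y\<bar> + \<bar>?c x - ?c y\<bar>" by (rule abs_triangle_ineq4)
    finally show ?thesis using c(3) by simp
  qed
  moreover have "(?k + 2) * \<bar>x - y\<bar> = ?k * \<bar>x - y\<bar> + 2 * \<bar>x - y\<bar>" by (rule distrib_right)
  ultimately show ?thesis unfolding trunc_def by linarith
qed

lemma locally_lipschitz_trunc:
  assumes "\<And>t. \<bar>l t\<bar> \<le> b" "\<bar>h\<bar> \<le> b"
  shows "locally_lipschitz (trunc l h)"
  unfolding locally_lipschitz_def using trunc_lipschitz[of l h] assms by blast

text \<open>Continuity in \<alpha> feeds the intermediate value theorem; the Lipschitz bound is kept
  because it shows how close to a known trajectory a start value must lie.\<close>

lemma trunc_flow:
  assumes l: "continuous_on UNIV l" "\<And>t. \<bar>l t\<bar> \<le> b" and h: "\<bar>h\<bar> \<le> b"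
  obtains U V where "\<And>\<alpha>. ode_on UNIV (trunc l h) (U \<alpha>) (V \<alpha>)" "\<And>\<alpha>. U \<alpha> 0 = \<alpha>" "\<And>\<alpha>. V \<alpha> 0 = 0"
    "\<And>t S. continuous_on S (\<lambda>\<alpha>. U \<alpha> t)" "\<And>t S. continuous_on S (\<lambda>\<alpha>. V \<alpha> t)"
    "\<And>c. \<exists>M>0. \<forall>\<alpha> \<beta> t. \<bar>t\<bar> \<le> c \<longrightarrow> \<bar>U \<alpha> t - U \<beta> t\<bar> \<le> M * \<bar>\<alpha> - \<beta>\<bar>"
proof (rule global_flow[of "trunc l h" "(3 * b^2 + lam) / \<epsilon>^2 + 2" "(b^3 + lam * b + 1) / \<epsilon>^2 + b"])
  show "continuous_on UNIV (\<lambda>p. trunc l h (fst p) (snd p))"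
    unfolding trunc_def rhs_def clip_def
    by (intro continuous_intros continuous_on_compose2[OF l(1)]) (use eps in auto)
  show "\<bar>trunc l h t x - trunc l h t y\<bar> \<le> ((3 * b^2 + lam) / \<epsilon>^2 + 2) * \<bar>x - y\<bar>" for t x y
    using l(2) h by (rule trunc_lipschitz)
  show "\<bar>trunc l h t 0\<bar> \<le> (b^3 + lam * b + 1) / \<epsilon>^2 + b" for t
  proof -
    let ?c = "clip (l t) h 0"
    have c: "\<bar>?c\<bar> \<le> b" using l(2)[of t] h by (auto simp: clip_def)
    have "\<bar>?c^3\<bar> \<le> b^3" "\<bar>lam * ?c\<bar> \<le> lam * b"
      using c lam_pos by (auto simp: power_abs abs_mult intro!: power_mono mult_left_mono)
    moreover have "\<bar>cos t\<bar> \<le> 1" by simp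
    ultimately have "\<bar>?c^3 - lam * ?c + cos t\<bar> \<le> b^3 + lam * b + 1" by linarith
    then have "\<bar>rhs t ?c\<bar> \<le> (b^3 + lam * b + 1) / \<epsilon>^2" unfolding rhs_def by (simp add: divide_right_mono)
    then show ?thesis using c unfolding trunc_def by linarith
  qed
next
  fix U V assume *: "\<And>\<alpha>. ode_on UNIV (trunc l h) (U \<alpha>) (V \<alpha>)" "\<And>\<alpha>. U \<alpha> 0 = \<alpha>" "\<And>\<alpha>. V \<alpha> 0 = 0"
    and lip: "\<And>c. \<exists>M>0. \<forall>\<alpha> \<beta> t. \<bar>t\<bar> \<le> c \<longrightarrow> \<bar>U \<alpha> t - U \<beta> t\<bar> \<le> M * \<bar>\<alpha> - \<beta>\<bar> \<and> \<bar>V \<alpha> t - V \<beta> t\<bar> \<le> M * \<bar>\<alpha> - \<beta>\<bar>"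
  have "continuous_on S (\<lambda>\<alpha>. U \<alpha> t) \<and> continuous_on S (\<lambda>\<alpha>. V \<alpha> t)" for t S
  proof -
    obtain M where "M > 0" "\<forall>\<alpha> \<beta>. \<bar>U \<alpha> t - U \<beta> t\<bar> \<le> M * \<bar>\<alpha> - \<beta>\<bar> \<and> \<bar>V \<alpha> t - V \<beta> t\<bar> \<le> M * \<bar>\<alpha> - \<beta>\<bar>"
      using lip[of "\<bar>t\<bar>"] by auto
    then have "M-lipschitz_on S (\<lambda>\<alpha>. U \<alpha> t)" "M-lipschitz_on S (\<lambda>\<alpha>. V \<alpha> t)"
      by (auto intro!: lipschitz_onI simp: dist_real_def)
    then show ?thesis by (auto intro: lipschitz_on_continuous_on)
  qed
  moreover have "\<exists>M>0. \<forall>\<alpha> \<beta> t. \<bar>t\<bar> \<le> c \<longrightarrow> \<bar>U \<alpha> t - U \<beta> t\<bar> \<le> M * \<bar>\<alpha> - \<beta>\<bar>" for c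
    using lip[of c] by meson
  ultimately show thesis using * by (intro that[of U V]) auto
qed

section \<open>Even periodic solutions as Neumann solutions\<close>

text \<open>The two symmetries are the even reflections of a solution on \<open>[0, \<pi>]\<close> at both end points;
  together they imply \<open>2\<pi>\<close>-periodicity.\<close>

definition neumann :: "(real \<Rightarrow> real) \<Rightarrow> bool" where
  "neumann u \<longleftrightarrow> (\<exists>v. ode_on UNIV rhs u v \<and> v 0 = 0 \<and> v pi = 0)
     \<and> (\<forall>t. u (- t) = u t) \<and> (\<forall>t. u (2 * pi - t) = u t)"

lemma neumannE:
  assumes "neumann u"
  obtains v where "ode_on UNIV rhs u v" "v 0 = 0" "v pi = 0"
  using assms unfolding neumann_def by blast

lemma neumann_reduce: "\<exists>s\<in>{0..pi}. \<forall>u. neumann u \<longrightarrow> u t = u s"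
  using reduce_to_half_period[of t] unfolding neumann_def by metis

lemma neumann_periodic_solution:
  assumes "neumann u"
  shows "periodic_solution \<epsilon> lam u" "deriv u 0 = 0" "deriv u pi = 0"
proof -
  obtain v where v: "ode_on UNIV rhs u v" "v 0 = 0" "v pi = 0" using assms by (rule neumannE)
  have "u (t + 2 * pi) = u t" for t
    using assms unfolding neumann_def by (metis add.commute diff_minus_eq_add)
  then show "periodic_solution \<epsilon> lam u" using v by (auto simp: periodic_solution_def solves_on_iff)
  show "deriv u 0 = 0" "deriv u pi = 0" using DERIV_imp_deriv[OF ode_onD(1)[OF v(1)]] v by auto
qed

lemma neumann_continuous: "neumann u \<Longrightarrow> continuous_on S u"
  by (erule neumannE) (auto intro!: continuous_at_imp_continuous_on DERIV_isCont dest: ode_onD(1))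

lemma rhs_odd: "rhs (pi - t) (- x) = - rhs t x"
  by (simp add: rhs_def cos_diff minus_divide_left power3_eq_cube)

lemma neumann_reflect:
  assumes "neumann u"
  shows "neumann (\<lambda>t. - u (pi - t))"
proof -
  obtain v where v: "ode_on UNIV rhs u v" "v 0 = 0" "v pi = 0" using assms by (rule neumannE)
  have "ode_on UNIV rhs (\<lambda>t. - u (pi - t)) (\<lambda>t. v (pi - t))"
    using v(1) rhs_odd by (rule ode_on_antireflect)
  moreover have "u (pi - - t) = u (pi - t)" for t
  proof -
    have "u (2 * pi - (pi - t)) = u (pi - t)" using assms unfolding neumann_def by blast
    moreover have "2 * pi - (pi - t) = pi - - t" by simp
    ultimately show ?thesis by (simp only:)
  qed
  moreover have "u (pi - (2 * pi - t)) = u (pi - t)" for t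
  proof -
    have "u (- (pi - t)) = u (pi - t)" using assms unfolding neumann_def by blast
    moreover have "- (pi - t) = pi - (2 * pi - t)" by simp
    ultimately show ?thesis by (simp only:)
  qed
  ultimately show ?thesis unfolding neumann_def using v by fastforce
qed

text \<open>The symmetries carry the weak order from \<open>{0..pi}\<close> to the whole line, where
  touching would force equality by \<open>ode_touching_eq\<close>.\<close>

lemma neumann_strict_order:
  assumes u: "neumann u" and w: "neumann w" and le: "\<And>t. t \<in> {0..pi} \<Longrightarrow> u t \<le> w t" and ne: "u \<noteq> w"
  shows "u t < w t"
proof -
  have le': "u t \<le> w t" for t
  proof -
    obtain r where "r \<in> {0..pi}" "\<forall>u. neumann u \<longrightarrow> u t = u r" using neumann_reduce[of t] by blast
    then show ?thesis using le u w by metis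
  qed
  obtain v where v: "ode_on UNIV rhs u v" using u by (rule neumannE)
  obtain z where z: "ode_on UNIV rhs w z" using w by (rule neumannE)
  show ?thesis
    using ode_touching_eq[OF locally_lipschitz_rhs v z le', of t] ne le'[of t] by force
qed

text \<open>A solution of the cubic equation need not extend globally, so the extension is taken
  from the truncated flow. Its reflections at \<open>0\<close> and \<open>pi\<close> solve the same
  problem with the same data there, hence coincide with it; the bound thus spreads from
  \<open>{0..pi}\<close> to all times and makes the truncation invisible.\<close>

lemma neumann_extension:
  assumes u: "ode_on {0..pi} rhs u v" "v 0 = 0" "v pi = 0" and bound: "\<And>t. t \<in> {0..pi} \<Longrightarrow> \<bar>u t\<bar> \<le> b"
  obtains w where "neumann w" "\<And>t. t \<in> {0..pi} \<Longrightarrow> w t = u t"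
proof -
  let ?F = "trunc (\<lambda>_. - b) b"
  have F: "locally_lipschitz ?F" using b by (intro locally_lipschitz_trunc) auto
  obtain U V where U: "\<And>\<alpha>. ode_on UNIV ?F (U \<alpha>) (V \<alpha>)" "\<And>\<alpha>. U \<alpha> 0 = \<alpha>" "\<And>\<alpha>. V \<alpha> 0 = 0"
    by (rule trunc_flow[of "\<lambda>_. - b" b]) (use b in auto)
  define w where "w = U (u 0)"
  define z where "z = V (u 0)"
  have w: "ode_on UNIV ?F w z" "w 0 = u 0" "z 0 = 0" unfolding w_def z_def by (rule U)+
  have "ode_on {0..pi} ?F u v"
  proof (rule ode_on_cong[OF u(1)])
    fix t assume "t \<in> {0..pi}"
    then show "rhs t (u t) = ?F t (u t)" using bound[of t] by (subst trunc_inside) auto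
  qed
  then have eq: "w t = u t \<and> z t = v t" if "t \<in> {0..pi}" for t
    using ode_on_unique[OF F ode_on_subset[OF w(1)], of 0 pi u v 0 t] w u that by auto
  have z0: "z pi = 0" using eq[of pi] u by simp
  have even: "w (- t) = w t" for t
  proof -
    have "ode_on UNIV ?F (\<lambda>t. w (0 - t)) (\<lambda>t. - z (0 - t))"
      using w(1) by (rule ode_on_reflect) (simp add: trunc_def rhs_def)
    from ode_unique[OF F this w(1), of 0] w show ?thesis by (auto dest: fun_cong)
  qed
  have sym: "w (2 * pi - t) = w t" for t
  proof -
    have "ode_on UNIV ?F (\<lambda>t. w (2 * pi - t)) (\<lambda>t. - z (2 * pi - t))"
      using w(1) by (rule ode_on_reflect) (simp add: trunc_def rhs_def cos_diff)
    from ode_unique[OF F this w(1), of pi] z0 show ?thesis by (auto dest: fun_cong)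
  qed
  have "\<bar>w t\<bar> \<le> b" for t
  proof -
    obtain r where "r \<in> {0..pi}" "w t = w r" using reduce_to_half_period[of t] even sym by metis
    then show ?thesis using eq[of r] bound[of r] by simp
  qed
  then have "ode_on UNIV rhs w z"
    by (intro ode_on_cong[OF w(1)] trunc_inside) (auto simp: abs_le_iff minus_le_iff)
  then have "neumann w" unfolding neumann_def using w z0 even sym by blast
  then show ?thesis using that eq by blast
qed

section \<open>The five solutions\<close>

lemma ex_upper: obtains u where "neumann u" "\<And>t. s < u t" "\<And>t. u t < b"
proof -
  let ?F = "trunc (\<lambda>_. s) b"
  obtain U V where U: "\<And>\<alpha>. ode_on UNIV ?F (U \<alpha>) (V \<alpha>)" "\<And>\<alpha>. U \<alpha> 0 = \<alpha>" "\<And>\<alpha>. V \<alpha> 0 = 0"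
    and cont: "\<And>t S. continuous_on S (\<lambda>\<alpha>. V \<alpha> t)"
    by (rule trunc_flow[of "\<lambda>_. s" b]) (use b s in auto)
  have above: "?F t x > 0" if "x - b \<ge> 0" for t x
    using that rhs_signs(1)[of t] s by (simp add: trunc_above)
  have below: "?F t x < 0" if "s - x \<ge> 0" for t x
    using that rhs_signs(3)[of t] s by (simp add: trunc_below)
  have du: "((\<lambda>t. U \<alpha> t - b) has_real_derivative V \<alpha> t) (at t)"
    "((\<lambda>t. s - U \<alpha> t) has_real_derivative - V \<alpha> t) (at t)"
    "(V \<alpha> has_real_derivative ?F t (U \<alpha> t)) (at t)"
    "((\<lambda>t. - V \<alpha> t) has_real_derivative - ?F t (U \<alpha> t)) (at t)" for \<alpha> t
    using ode_onD[OF U(1)[of \<alpha>], of t] by (auto intro!: derivative_eq_intros)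
  \<comment> \<open>Trajectories released at rest on the two barriers leave the strip in opposite
    directions, so their slopes at \<open>pi\<close> have opposite signs.\<close>
  have "V b pi > 0"
    by (rule growth[OF du(1) du(3), of 0 pi]) (use above U in auto)
  moreover have "- V s pi > 0"
    by (rule growth[OF du(2) du(4), of 0 pi]) (use below U in auto)
  ultimately obtain \<alpha> where \<alpha>: "V \<alpha> pi = 0"
    using IVT'[of "\<lambda>\<alpha>. V \<alpha> pi" s 0 b] cont s by force
  have lt: "U \<alpha> t < b" "s < U \<alpha> t" if t: "t \<in> {0..pi}" for t
    using max_principle[OF pi_gt_zero du(1) du(3), of \<alpha> t] max_principle[OF pi_gt_zero du(2) du(4), of \<alpha> t]
      above below \<alpha> U t by auto
  have "ode_on {0..pi} rhs (U \<alpha>) (V \<alpha>)"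
    by (rule ode_on_cong[OF ode_on_subset[OF U(1)]]) (use lt in \<open>force simp: trunc_inside\<close>)+
  moreover have "\<bar>U \<alpha> t\<bar> \<le> b" if "t \<in> {0..pi}" for t using lt[OF that] s by auto
  ultimately obtain w where w: "neumann w" "\<And>t. t \<in> {0..pi} \<Longrightarrow> w t = U \<alpha> t"
    using neumann_extension U(3) \<alpha> by metis
  have "s < w t \<and> w t < b" for t
    using neumann_reduce[of t] w lt by metis
  then show ?thesis using that w by blast
qed

text \<open>Where \<open>w > u > s\<close> the right-hand side is strictly increasing, so with
  Neumann conditions at both ends \<open>w - u\<close> has no positive maximum.\<close>

lemma neumann_le_upper:
  assumes u: "neumann u" "\<And>t. s < u t" and w: "neumann w" and t: "t \<in> {0..pi}"
  shows "w t \<le> u t"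
proof -
  obtain v where v: "ode_on UNIV rhs u v" "v 0 = 0" "v pi = 0" using u(1) by (rule neumannE)
  obtain z where z: "ode_on UNIV rhs w z" "z 0 = 0" "z pi = 0" using w by (rule neumannE)
  have "w t - u t \<le> 0"
  proof (rule max_principle_weak[OF pi_gt_zero, of "\<lambda>t. w t - u t" "\<lambda>t. z t - v t" "\<lambda>t. rhs t (w t) - rhs t (u t)"])
    show "((\<lambda>t. w t - u t) has_real_derivative z t - v t) (at t)"
      "((\<lambda>t. z t - v t) has_real_derivative rhs t (w t) - rhs t (u t)) (at t)" for t
      using ode_onD[OF v(1)] ode_onD[OF z(1)] by (auto intro!: DERIV_diff)
    fix t assume "w t - u t > 0"
    then show "rhs t (w t) - rhs t (u t) > 0" using rhs_strict_mono[of "u t" "w t" t] u(2)[of t] by simp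
  qed (use v z t in auto)
  then show ?thesis by simp
qed

section \<open>The middle solution, by shooting on a quarter period\<close>

lemma cos_pos_half: "0 \<le> t \<Longrightarrow> t < pi / 2 \<Longrightarrow> cos t > 0"
  by (rule cos_gt_zero_pi) auto

lemma trunc_zero: "0 \<le> x \<Longrightarrow> trunc (\<lambda>_. - b) 0 t x = cos t / \<epsilon>^2 + x"
  using b by (simp add: trunc_above rhs_def)

lemma ex_quarter:
  obtains u v where "ode_on {0..pi/2} rhs u v" "v 0 = 0" "u (pi/2) = 0"
    "\<And>t. t \<in> {0..pi/2} \<Longrightarrow> - b \<le> u t" "\<And>t. 0 \<le> t \<Longrightarrow> t < pi/2 \<Longrightarrow> u t < 0"
proof -
  let ?F = "trunc (\<lambda>_. - b) 0"
  obtain U V where U: "\<And>\<alpha>. ode_on UNIV ?F (U \<alpha>) (V \<alpha>)" "\<And>\<alpha>. U \<alpha> 0 = \<alpha>" "\<And>\<alpha>. V \<alpha> 0 = 0"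
    and cont: "\<And>t S. continuous_on S (\<lambda>\<alpha>. U \<alpha> t)"
    by (rule trunc_flow[of "\<lambda>_. - b" 0]) (use b in auto)
  \<comment> \<open>The upper barrier \<open>0\<close> is strict only before \<open>pi/2\<close>,
    where the forcing vanishes; hence the half-open interval.\<close>
  have above: "?F t x > 0" if "x \<ge> 0" "0 \<le> t" "t < pi/2" for t x
    using that cos_pos_half[of t] eps by (simp add: trunc_zero add_pos_nonneg)
  have below: "?F t x < 0" if "- b - x \<ge> 0" for t x
    using that rhs_signs(2)[of t] b by (simp add: trunc_below)
  have du: "(U \<alpha> has_real_derivative V \<alpha> t) (at t)"
    "((\<lambda>t. - b - U \<alpha> t) has_real_derivative - V \<alpha> t) (at t)"
    "(V \<alpha> has_real_derivative ?F t (U \<alpha> t)) (at t)"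
    "((\<lambda>t. - V \<alpha> t) has_real_derivative - ?F t (U \<alpha> t)) (at t)" for \<alpha> t
    using ode_onD[OF U(1)[of \<alpha>], of t] by (auto intro!: derivative_eq_intros)
  \<comment> \<open>A trajectory that is nonnegative and not falling before \<open>pi/2\<close>
    keeps rising. This gives the sign at the start value \<open>0\<close> and later prevents the
    solution found from reaching \<open>0\<close> early.\<close>
  have escape: "U \<alpha> (pi/2) > 0" if "0 \<le> c" "c < pi/2" "U \<alpha> c \<ge> 0" "V \<alpha> c \<ge> 0" for \<alpha> c
  proof -
    have V: "V \<alpha> t > 0" if "c < t" "t < pi/2" for t
      by (rule growth[OF du(1) du(3), of c t]) (use that \<open>0 \<le> c\<close> \<open>U \<alpha> c \<ge> 0\<close> \<open>V \<alpha> c \<ge> 0\<close> above in auto)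
    have "U \<alpha> c < U \<alpha> (pi/2)"
    proof (rule DERIV_pos_imp_increasing_open[OF \<open>c < pi/2\<close>])
      show "\<exists>y. (U \<alpha> has_real_derivative y) (at t) \<and> 0 < y" if "c < t" "t < pi/2" for t
        using du(1) V[OF that] by blast
      show "continuous_on {c..pi/2} (U \<alpha>)"
        by (intro continuous_at_imp_continuous_on ballI DERIV_isCont[OF du(1)])
    qed
    then show ?thesis using that by simp
  qed
  have "U 0 (pi/2) > 0" using escape[of 0 0] U by simp
  moreover have "- b - U (- b) (pi/2) > 0"
  proof -
    have V: "- V (- b) t > 0" if "0 < t" "t \<le> pi/2" for t
      by (rule growth[OF du(2) du(4), of 0 "pi/2"]) (use that below U in auto)
    have "- b - U (- b) 0 < - b - U (- b) (pi/2)"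
      by (rule DERIV_pos_imp_increasing_open[of 0 "pi/2"])
        (use du(2) V in \<open>force intro!: continuous_at_imp_continuous_on DERIV_isCont[OF du(2)]\<close>)+
    then show ?thesis using U by simp
  qed
  ultimately obtain \<alpha> where \<alpha>: "U \<alpha> (pi/2) = 0"
    using IVT'[of "\<lambda>\<alpha>. U \<alpha> (pi/2)" "- b" 0 0] cont b by force
  have lower: "- b < U \<alpha> t" if t: "t \<in> {0..pi/2}" for t
    using max_principle[OF pi_half_gt_zero du(2) du(4), of \<alpha> t] below \<alpha> U t b by auto
  \<comment> \<open>At a nonnegative value, \<open>escape\<close> excludes velocity
    \<open>>= 0\<close>, while a negative velocity is the right-hand Neumann condition under which
    the maximum principle on \<open>{0..t}\<close> gives \<open>U \<alpha> t < 0\<close>.\<close>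
  have neg: "U \<alpha> t < 0" if t: "0 \<le> t" "t < pi/2" for t
  proof (rule ccontr)
    assume "\<not> U \<alpha> t < 0"
    have "V \<alpha> t < 0" using escape[OF t, of \<alpha>] \<alpha> \<open>\<not> U \<alpha> t < 0\<close> by force
    then have "t \<noteq> 0" using U by auto
    then have "0 < t" using t by simp
    then have "U \<alpha> t < 0"
      by (rule max_principle[OF _ du(1) du(3)]) (use above U \<open>V \<alpha> t < 0\<close> t in auto)
    then show False using \<open>\<not> U \<alpha> t < 0\<close> by simp
  qed
  have nonpos: "U \<alpha> t \<le> 0" if "t \<in> {0..pi/2}" for t
    using neg[of t] \<alpha> that by (metis atLeastAtMost_iff less_eq_real_def)
  have "ode_on {0..pi/2} rhs (U \<alpha>) (V \<alpha>)"
    by (rule ode_on_cong[OF ode_on_subset[OF U(1)]]) (use lower nonpos in \<open>force simp: trunc_inside\<close>)+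
  then show ?thesis using that[of "U \<alpha>" "V \<alpha>"] U \<alpha> lower neg by force
qed

text \<open>The quarter solution is continued globally by the truncated flow. Since it vanishes at
  \<open>pi/2\<close>, the continuation \<open>w\<close> and \<open>- w (pi - t)\<close> have the
  same data there and coincide; so the zero velocity at \<open>0\<close> reappears at
  \<open>pi\<close>.\<close>

lemma ex_middle:
  obtains u where "neumann u" "u (pi/2) = 0" "\<And>t. 0 \<le> t \<Longrightarrow> t < pi/2 \<Longrightarrow> u t < 0"
    "\<And>t. \<bar>u t\<bar> \<le> b" "\<And>t. - u (pi - t) = u t"
proof -
  obtain u v where u: "ode_on {0..pi/2} rhs u v" "v 0 = 0" "u (pi/2) = 0"
    "\<And>t. t \<in> {0..pi/2} \<Longrightarrow> - b \<le> u t" "\<And>t. 0 \<le> t \<Longrightarrow> t < pi/2 \<Longrightarrow> u t < 0"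
    using ex_quarter by blast
  have nonpos: "u t \<le> 0" if "t \<in> {0..pi/2}" for t
    using u(5)[of t] u(3) that by (metis atLeastAtMost_iff less_eq_real_def)
  let ?F = "trunc (\<lambda>_. - b) b"
  have F: "locally_lipschitz ?F" using b by (intro locally_lipschitz_trunc) auto
  obtain U V where U: "\<And>\<alpha>. ode_on UNIV ?F (U \<alpha>) (V \<alpha>)" "\<And>\<alpha>. U \<alpha> 0 = \<alpha>" "\<And>\<alpha>. V \<alpha> 0 = 0"
    by (rule trunc_flow[of "\<lambda>_. - b" b]) (use b in auto)
  define w where "w = U (u 0)"
  define z where "z = V (u 0)"
  have w: "ode_on UNIV ?F w z" "w 0 = u 0" "z 0 = 0" unfolding w_def z_def by (rule U)+
  have "ode_on {0..pi/2} ?F u v"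
  proof (rule ode_on_cong[OF u(1)])
    fix t assume "t \<in> {0..pi/2}"
    then show "rhs t (u t) = ?F t (u t)" using u(4)[of t] nonpos[of t] b by (subst trunc_inside) auto
  qed
  then have eq: "w t = u t" if "t \<in> {0..pi/2}" for t
    using ode_on_unique[OF F ode_on_subset[OF w(1)], of 0 "pi/2" u v 0 t] w u that by auto
  have "?F (pi - t) (- x) = - ?F t x" for t x
  proof -
    have "clip (- b) b (- x) = - clip (- b) b x" using b by (auto simp: clip_def)
    then show ?thesis by (simp add: trunc_def rhs_odd)
  qed
  then have "ode_on UNIV ?F (\<lambda>t. - w (pi - t)) (\<lambda>t. z (pi - t))"
    by (rule ode_on_antireflect[OF w(1)])
  moreover have "w (pi/2) = 0" using eq[of "pi/2"] u by simp
  ultimately have anti: "(\<lambda>t. - w (pi - t)) = w \<and> (\<lambda>t. z (pi - t)) = z"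
    by (intro ode_unique[OF F _ w(1), of _ _ "pi/2"]) auto
  then have anti': "- w (pi - t) = w t" "z (pi - t) = z t" for t by metis+
  have bound: "\<bar>w t\<bar> \<le> b" if "t \<in> {0..pi}" for t
  proof (cases "t \<le> pi/2")
    case True
    then show ?thesis using eq[of t] u(4)[of t] nonpos[of t] that b by auto
  next
    case False
    then have "pi - t \<in> {0..pi/2}" using that by auto
    then show ?thesis using eq[of "pi - t"] u(4)[of "pi - t"] nonpos[of "pi - t"] anti'(1)[of t] b by auto
  qed
  have "ode_on {0..pi} rhs w z"
  proof (rule ode_on_cong[OF ode_on_subset[OF w(1)]])
    fix t assume "t \<in> {0..pi}"
    then show "?F t (w t) = rhs t (w t)" using bound[of t] by (intro trunc_inside) auto
  qed simp
  moreover have "z pi = 0" using anti'(2)[of 0] w by simp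
  ultimately obtain x where x: "neumann x" "\<And>t. t \<in> {0..pi} \<Longrightarrow> x t = w t"
    using neumann_extension[of w z] w bound by blast
  have b': "\<bar>x t\<bar> \<le> b" for t using neumann_reduce[of t] x bound by metis
  have "- x (pi - t) = x t" for t
  proof -
    obtain r where r: "r \<in> {0..pi}" "\<forall>u. neumann u \<longrightarrow> u t = u r" using neumann_reduce[of t] by blast
    then have "- x (pi - t) = - x (pi - r)" using neumann_reflect[OF x(1)] by blast
    also have "\<dots> = - w (pi - r)" using x(2)[of "pi - r"] r by auto
    also have "\<dots> = x t" using anti'(1)[of r] x r by metis
    finally show ?thesis .
  qed
  moreover have "x t = u t" if "t \<in> {0..pi/2}" for t
    using x(2)[of t] eq[OF that] that by (auto simp: field_simps)
  ultimately show ?thesis using that[of x] x b' u by auto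
qed

text \<open>At a point with \<open>u' \<le> 0\<close> and \<open>u'' \<le> 0\<close> the equation forces \<open>u < - s\<close>. As long as \<open>u \<le> - s\<close>, the
  function \<open>z = - u'\<close> satisfies \<open>\<epsilon>\<^sup>2 z'' = (3 u\<^sup>2 - lam) z + sin t\<close> with nonnegative coefficient, so \<open>z\<close>
  grows and \<open>u\<close> never gets back up to \<open>- s\<close>, let alone to \<open>0\<close>.\<close>

lemma middle_increasing:
  assumes u: "ode_on UNIV rhs u v" "v 0 = 0" "u (pi/2) = 0"
    and neg: "\<And>t. 0 \<le> t \<Longrightarrow> t < pi/2 \<Longrightarrow> u t < 0" and t0: "0 < t0" "t0 < pi/2"
  shows "v t0 > 0"
proof (rule ccontr)
  assume "\<not> v t0 > 0"
  \<comment> \<open>The third derivative of \<open>u\<close>, that is, the derivative of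
    \<open>rhs t (u t)\<close> along the solution.\<close>
  define e where "e t = (3 * (u t)^2 - lam) * v t / \<epsilon>^2 - sin t / \<epsilon>^2" for t
  have du: "(u has_real_derivative v t) (at t)" "(v has_real_derivative rhs t (u t)) (at t)" for t
    using ode_onD[OF u(1)] .
  have drhs: "((\<lambda>t. rhs t (u t)) has_real_derivative e t) (at t)" for t
    unfolding rhs_def e_def using eps
    by (auto intro!: derivative_eq_intros du simp: field_simps power2_eq_square)
  have contu: "continuous_on S u" and contv: "continuous_on S v" for S
    by (intro continuous_at_imp_continuous_on ballI DERIV_isCont[OF du(1)] DERIV_isCont[OF du(2)])+
  obtain m where m: "m \<in> {0..t0}" "\<And>t. t \<in> {0..t0} \<Longrightarrow> v m \<le> v t"
    using continuous_attains_inf[of "{0..t0}" v] contv t0 by auto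
  \<comment> \<open>If the minimum of \<open>v\<close> sits at \<open>0\<close>, where
    \<open>v = 0\<close>, then \<open>v t0 <= 0\<close> makes \<open>t0\<close> a minimum point as
    well. So \<open>t1\<close> can be taken positive, with room to its left.\<close>
  define t1 where "t1 = (if m = 0 then t0 else m)"
  have t1: "0 < t1" "t1 \<le> t0" using m t0 by (auto simp: t1_def)
  have min: "v t1 \<le> v t" if "t \<in> {0..t0}" for t
    using m(2)[OF that] \<open>\<not> v t0 > 0\<close> u by (auto simp: t1_def)
  have vt1: "v t1 \<le> 0" using min[of t0] \<open>\<not> v t0 > 0\<close> t0 by simp
  \<comment> \<open>Minimality seen from the left gives \<open>u'' <= 0\<close>, also when
    \<open>t1\<close> is the right end \<open>t0\<close>.\<close>
  have rhs1: "rhs t1 (u t1) \<le> 0"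
  proof (rule ccontr)
    assume "\<not> rhs t1 (u t1) \<le> 0"
    then obtain d where d: "d > 0" "\<And>h. h > 0 \<Longrightarrow> h < d \<Longrightarrow> v (t1 - h) < v t1"
      using DERIV_pos_inc_left[OF du(2), of t1] by force
    define h where "h = min (d/2) t1"
    have "h > 0" "h < d" "h \<le> t1" using d t1 by (auto simp: h_def)
    then show False using d(2)[of h] min[of "t1 - h"] t1 by auto
  qed
  have ut1: "u t1 < - s"
  proof -
    have "u t1 ^ 3 - lam * u t1 + cos t1 \<le> 0"
      using rhs1 eps by (simp add: rhs_def divide_le_0_iff)
    moreover have "cos t1 > 0" using cos_pos_half[of t1] t1 t0 by simp
    ultimately have "u t1 * (u t1 ^ 2 - lam) < 0" by (simp add: power2_eq_square power3_eq_cube algebra_simps)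
    then have "lam < (u t1)^2" using neg[of t1] t1 t0 by (auto simp: mult_less_0_iff)
    then have "s^2 < (- u t1)^2" using lam_pos s(2) by simp
    then have "s < - u t1" by (rule power_less_imp_less_base) (use neg[of t1] t1 t0 in simp)
    then show ?thesis by simp
  qed
  \<comment> \<open>The first return to \<open>- s\<close>, which exists because
    \<open>u (pi/2) = 0\<close>. The contradiction will be that \<open>u\<close> does not increase
    on \<open>{t1..r}\<close>.\<close>
  obtain r where r: "t1 < r" "r \<le> pi/2" "u r + s = 0" "\<And>t. t1 \<le> t \<Longrightarrow> t < r \<Longrightarrow> u t + s < 0"
    by (rule first_zero[of t1 "pi/2" "\<lambda>t. u t + s"]) (use contu ut1 u s t1 t0 in \<open>auto intro!: continuous_intros\<close>)
  have rhs_neg: "- rhs t (u t) > 0" if "t1 < t" "t \<le> r" for t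
  proof (rule growth[of "\<lambda>t. - v t" "\<lambda>t. - rhs t (u t)" "\<lambda>t. - e t" t1 r])
    show "((\<lambda>t. - v t) has_real_derivative - rhs t (u t)) (at t)"
      "((\<lambda>t. - rhs t (u t)) has_real_derivative - e t) (at t)" for t
      using du(2) drhs by (auto intro!: DERIV_minus)
    fix t assume t: "t \<in> {t1..r}" "- v t \<ge> 0"
    have "u t \<le> - s" using r(3) r(4)[of t] t by (cases "t = r") auto
    then have "s^2 \<le> (- u t)^2" using s by (intro power_mono) auto
    then have "3 * (u t)^2 - lam \<ge> 0" using s(2) by simp
    then have "(3 * (u t)^2 - lam) * v t \<le> 0" using t by (simp add: mult_nonneg_nonpos)
    moreover have "sin t > 0" using t t1 r pi_gt_zero by (intro sin_gt_zero) auto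
    ultimately have "((3 * (u t)^2 - lam) * v t - sin t) / \<epsilon>^2 < 0"
      using eps by (intro divide_neg_pos) auto
    then show "- e t > 0" by (simp add: e_def diff_divide_distrib)
  qed (use that vt1 rhs1 in auto)
  have v_neg: "- v t1 \<le> - v t" if "t1 < t" "t \<le> r" for t
  proof (rule mono_within[of t1 t "\<lambda>t. - v t" "\<lambda>t. - rhs t (u t)"])
    show "((\<lambda>t. - v t) has_real_derivative - rhs x (u x)) (at x within {t1..t})" for x
      using DERIV_subset[OF du(2)] by (auto intro!: DERIV_minus)
  qed (use rhs_neg that in \<open>auto simp: less_imp_le\<close>)
  have "- u t1 \<le> - u r"
  proof (rule mono_within[of t1 r "\<lambda>t. - u t" "\<lambda>t. - v t"])
    show "((\<lambda>t. - u t) has_real_derivative - v t) (at t within {t1..r})" for t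
      using DERIV_subset[OF du(1)] by (auto intro!: DERIV_minus)
  qed (use v_neg vt1 r in force)+
  then show False using r(3) ut1 by simp
qed

section \<open>Wronskian comparison and the solution above the middle one\<close>

text \<open>For \<open>x < 0\<close> and \<open>cos t > 0\<close> the quotient \<open>rhs t x / x\<close> is strictly decreasing in \<open>x\<close>; hence the
  Wronskian of two ordered negative solutions is strictly monotone.\<close>

lemma negative_solutions_meet:
  assumes x: "ode_on {0..T} rhs x vx" "vx 0 = 0" and y: "ode_on {0..T} rhs y vy" "vy 0 = 0"
    and m: "0 < m" "m \<le> T" "m \<le> pi/2" "x m = y m" "y m \<le> 0"
    and lt: "\<And>t. 0 \<le> t \<Longrightarrow> t < m \<Longrightarrow> x t < y t \<and> y t < 0"
  shows False
proof -
  have d: "(x has_real_derivative vx t) (at t within {0..m})" "(vx has_real_derivative rhs t (x t)) (at t within {0..m})"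
     "(y has_real_derivative vy t) (at t within {0..m})" "(vy has_real_derivative rhs t (y t)) (at t within {0..m})"
    if "t \<in> {0..m}" for t
    using ode_on_subset[OF x(1), of "{0..m}"] ode_on_subset[OF y(1), of "{0..m}"] m that by (auto simp: ode_on_def)
  define N where "N t = vy t * x t - vx t * y t" for t
  have dN: "(N has_real_derivative rhs t (y t) * x t - rhs t (x t) * y t) (at t within {0..m})" if "t \<in> {0..m}" for t
    unfolding N_def by (rule derivative_eq_intros d[OF that] refl)+ simp
  have neg: "rhs t (y t) * x t - rhs t (x t) * y t < 0" if t: "0 < t" "t < m" for t
  proof -
    have *: "x t < y t" "x t < 0" "y t < 0" using lt[of t] t by auto
    have "rhs t (y t) * x t - rhs t (x t) * y t = (y t - x t) * (x t * y t * (x t + y t) - cos t) / \<epsilon>^2"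
      by (simp add: rhs_def power3_eq_cube diff_divide_distrib[symmetric] algebra_simps)
    moreover have "x t * y t * (x t + y t) < 0" using * by (intro mult_pos_neg mult_neg_neg) auto
    moreover have "cos t > 0" using cos_pos_half[of t] t m by simp
    ultimately show ?thesis using * eps by (simp add: mult_pos_neg divide_neg_pos)
  qed
  obtain c where c: "c \<in> {0<..<m}" "N m - N 0 = (rhs c (y c) * x c - rhs c (x c) * y c) * m"
    using mvt_simple[OF m(1), of N "\<lambda>t h. (rhs t (y t) * x t - rhs t (x t) * y t) * h"] dN
    by (auto simp: has_field_derivative_def)
  \<comment> \<open>The zero initial velocities give \<open>N 0 = 0\<close>, and
    \<open>x m = y m\<close> gives \<open>N m = (vy m - vx m) * y m\<close>. Negativity excludes
    \<open>y m = 0\<close> and yields \<open>vy m > vx m\<close>, impossible when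
    \<open>y - x\<close> is positive before \<open>m\<close> and zero at \<open>m\<close>.\<close>
  have "N m < 0" using c neg[of c] m x y by (simp add: N_def mult_neg_pos)
  then have "(vy m - vx m) * y m < 0" using m by (simp add: N_def algebra_simps)
  then have "vy m - vx m > 0" using m by (auto simp: mult_less_0_iff)
  moreover have "((\<lambda>t. y t - x t) has_real_derivative vy m - vx m) (at m within {0..m})"
    using d[of m] m by (auto intro!: DERIV_diff)
  ultimately obtain e where e: "e > 0" "\<And>h. h > 0 \<Longrightarrow> m - h \<in> {0..m} \<Longrightarrow> h < e \<Longrightarrow> y (m - h) - x (m - h) < y m - x m"
    using has_real_derivative_pos_inc_left[of "\<lambda>t. y t - x t"] by blast
  define h where "h = min (e/2) m"
  have "h > 0" "h < e" "h \<le> m" using e m by (auto simp: h_def)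
  then show False using e(2)[of h] lt[of "m - h"] m by auto
qed

lemma ex_above_middle:
  assumes x: "neumann x" "\<And>t. \<bar>x t\<bar> \<le> b" "\<And>t. 0 \<le> t \<Longrightarrow> t < pi/2 \<Longrightarrow> x t < 0"
    and u: "neumann u" "\<And>t. s < u t" "\<And>t. u t < b"
    and y: "ode_on {0..T} rhs y vy" "vy 0 = 0" "strict_mono_on {0..T} y" "y 0 < 0" "y T = b"
    and T: "0 < T" "T < pi/2"
  obtains w where "neumann w" "\<And>t. x t < w t" "\<And>t. w t < u t"
proof -
  obtain vx where vx: "ode_on UNIV rhs x vx" "vx 0 = 0" "vx pi = 0" using x(1) by (rule neumannE)
  obtain vu where vu: "ode_on UNIV rhs u vu" "vu 0 = 0" "vu pi = 0" using u(1) by (rule neumannE)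
  have xT: "ode_on {0..T} rhs x vx" using vx(1) by (rule ode_on_subset) simp
  have xneg: "x t < 0" if "t \<in> {0..T}" for t using x(3)[of t] that T by simp
  have contx: "continuous_on S x" for S using x(1) by (rule neumann_continuous)
  have conty: "continuous_on {0..T} y" using y(1) by (auto simp: ode_on_def intro!: DERIV_continuous_on)
  have ymono: "y t < y t'" if "0 \<le> t" "t < t'" "t' \<le> T" for t t'
    using strict_mono_onD[OF y(3)] that by auto
  \<comment> \<open>Since \<open>y T = b > 0 > x T\<close>, a lower start would force a meeting with
    \<open>x\<close> while both are negative, and an equal start would force \<open>y = x\<close> up
    to \<open>T\<close>.\<close>
  have xy0: "x 0 < y 0"
  proof (rule ccontr)
    assume "\<not> x 0 < y 0"
    then consider "y 0 < x 0" | "y 0 = x 0" by linarith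
    then show False
    proof cases
      case 1
      obtain m where m: "0 < m" "m \<le> T" "y m - x m = 0" "\<And>t. 0 \<le> t \<Longrightarrow> t < m \<Longrightarrow> y t - x t < 0"
        by (rule first_zero[of 0 T "\<lambda>t. y t - x t"])
          (use 1 contx conty T b y xneg[of T] in \<open>auto intro!: continuous_intros\<close>)
      show False
        by (rule negative_solutions_meet[OF y(1,2) xT vx(2) m(1,2)])
          (use m T xneg[of m] in \<open>auto intro!: xneg\<close>)
    next
      case 2
      then have "y T = x T"
        using ode_on_unique[OF locally_lipschitz_rhs y(1) xT, of 0 T] y vx T by auto
      then show False using xneg[of T] b y T by simp
    qed
  qed
  \<comment> \<open>Monotonicity keeps \<open>y\<close> negative before a first meeting with the
    negative \<open>x\<close>, as the Wronskian comparison requires.\<close>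
  have xy: "x t < y t" if t: "t \<in> {0..T}" for t
  proof (rule ccontr)
    assume "\<not> x t < y t"
    have "continuous_on {0..t} (\<lambda>t. x t - y t)"
      using t by (intro continuous_intros contx continuous_on_subset[OF conty]) auto
    then obtain m where m: "0 < m" "m \<le> t" "x m - y m = 0" "\<And>t. 0 \<le> t \<Longrightarrow> t < m \<Longrightarrow> x t - y t < 0"
      by (rule first_zero) (use xy0 t \<open>\<not> x t < y t\<close> in auto)
    have ym: "y m < 0" using m t xneg[of m] by simp
    show False
    proof (rule negative_solutions_meet[OF xT vx(2) y(1,2) m(1)])
      fix r assume r: "0 \<le> r" "r < m"
      have "y r < y m" using ymono[of r m] r m t by simp
      then show "x r < y r \<and> y r < 0" using m(4)[OF r] ym by simp
    qed (use m t T ym in auto)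
  qed
  let ?F = "trunc x b"
  have F: "locally_lipschitz ?F" using x b by (intro locally_lipschitz_trunc) auto
  obtain U V where U: "\<And>\<alpha>. ode_on UNIV ?F (U \<alpha>) (V \<alpha>)" "\<And>\<alpha>. U \<alpha> 0 = \<alpha>" "\<And>\<alpha>. V \<alpha> 0 = 0"
    and cont: "\<And>t S. continuous_on S (\<lambda>\<alpha>. V \<alpha> t)"
    and lip: "\<And>c. \<exists>M>0. \<forall>\<alpha> \<beta> t. \<bar>t\<bar> \<le> c \<longrightarrow> \<bar>U \<alpha> t - U \<beta> t\<bar> \<le> M * \<bar>\<alpha> - \<beta>\<bar>"
    by (rule trunc_flow[of x b]) (use x b contx in auto)
  have xb: "x t \<le> b" for t using x(2)[of t] by simp
  have dU: "(U \<alpha> has_real_derivative V \<alpha> t) (at t)" "(V \<alpha> has_real_derivative ?F t (U \<alpha> t)) (at t)" for \<alpha> t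
    using ode_onD[OF U(1)[of \<alpha>], of t] .
  have dUb: "((\<lambda>t. U \<alpha> t - b) has_real_derivative V \<alpha> t) (at t)" for \<alpha> t
    using dU by (auto intro!: derivative_eq_intros)
  have above: "?F t r > 0" if "r - b \<ge> 0" for t r
    using that rhs_signs(1)[of t] xb[of t] by (simp add: trunc_above)
  \<comment> \<open>Up to \<open>T\<close> the truncated trajectory is \<open>y\<close> itself; it
    arrives at the barrier \<open>b\<close> with nonnegative velocity and then rises until
    \<open>pi\<close>.\<close>
  have up: "V (y 0) pi > 0"
  proof -
    have "ode_on {0..T} ?F y vy"
    proof (rule ode_on_cong[OF y(1)])
      fix t assume t: "t \<in> {0..T}"
      then have "y t \<le> b" using ymono[of t T] y(5) by (cases "t = T") auto
      then show "rhs t (y t) = ?F t (y t)" using xy[OF t] by (simp add: trunc_inside)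
    qed
    moreover have "ode_on {0..T} ?F (U (y 0)) (V (y 0))" by (rule ode_on_subset[OF U(1)]) simp
    ultimately have "U (y 0) T = y T \<and> V (y 0) T = vy T"
      by (intro ode_on_unique[OF F, of 0 T _ _ _ _ 0]) (use U(2,3) y(2) T in auto)
    then have eq: "U (y 0) T = y T" "V (y 0) T = vy T" by auto
    have "vy T \<ge> 0"
    proof (rule ccontr)
      assume "\<not> vy T \<ge> 0"
      moreover have "(y has_real_derivative vy T) (at T within {0..T})" using y(1) T by (simp add: ode_on_def)
      ultimately obtain e where e: "e > 0" "\<And>h. h > 0 \<Longrightarrow> T - h \<in> {0..T} \<Longrightarrow> h < e \<Longrightarrow> y T < y (T - h)"
        using has_real_derivative_neg_dec_left[of y "vy T" T "{0..T}"] by auto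
      define h where "h = min (e/2) T"
      have "h > 0" "h < e" "h \<le> T" using e T by (auto simp: h_def)
      then show False using e(2)[of h] ymono[of "T - h" T] by auto
    qed
    then show ?thesis
      using growth[OF dUb dU(2), of T pi "y 0" pi] above eq y T by auto
  qed
  \<comment> \<open>\<open>u\<close> lies in the strip between \<open>x\<close> and
    \<open>b\<close>, so it is also the truncated trajectory from \<open>u 0\<close> and can be
    compared with its neighbours.\<close>
  have ode_u: "ode_on UNIV ?F u vu"
  proof (rule ode_on_cong[OF vu(1)])
    fix t
    have "x t \<le> u t"
    proof -
      obtain r where "r \<in> {0..pi}" "\<forall>u. neumann u \<longrightarrow> u t = u r" using neumann_reduce[of t] by blast
      then show ?thesis using neumann_le_upper[OF u(1,2) x(1), of r] u x by metis
    qed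
    then show "rhs t (u t) = ?F t (u t)" using u(3)[of t] by (simp add: trunc_inside)
  qed
  have Uu: "U (u 0) = u" using ode_unique[OF F U(1) ode_u, of "u 0" 0] U vu by auto
  \<comment> \<open>A start so close below \<open>u 0\<close> that Lipschitz dependence keeps the
    trajectory above \<open>s\<close>, where \<open>trunc\<close> is strictly increasing. The gap to
    \<open>u\<close> then widens, so the slope at \<open>pi\<close> is below
    \<open>vu pi = 0\<close>. The midpoint in the maximum keeps \<beta> above
    \<open>y 0\<close>.\<close>
  obtain \<beta> where \<beta>: "y 0 < \<beta>" "\<beta> < u 0" "V \<beta> pi < 0"
  proof -
    obtain r where r: "r \<in> {0..pi}" "\<And>t. t \<in> {0..pi} \<Longrightarrow> u r \<le> u t"
      using continuous_attains_inf[of "{0..pi}" u] neumann_continuous[OF u(1)] by auto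
    obtain M where M: "M > 0" "\<And>\<alpha> \<beta> t. \<bar>t\<bar> \<le> pi \<Longrightarrow> \<bar>U \<alpha> t - U \<beta> t\<bar> \<le> M * \<bar>\<alpha> - \<beta>\<bar>"
      using lip[of pi] by blast
    define e where "e = (u r - s) / M"
    define \<beta> where "\<beta> = max ((y 0 + u 0) / 2) (u 0 - e)"
    have "y 0 < u 0" using y(4) u(2)[of 0] s by simp
    moreover have "e > 0" using u(2)[of r] M by (simp add: e_def)
    ultimately have \<beta>: "y 0 < \<beta>" "\<beta> < u 0" "\<bar>\<beta> - u 0\<bar> \<le> e" by (auto simp: \<beta>_def max_def field_simps)
    have low: "s \<le> U \<beta> t" if t: "t \<in> {0..pi}" for t
    proof -
      have "\<bar>U \<beta> t - u t\<bar> \<le> M * \<bar>\<beta> - u 0\<bar>" using M(2)[of t \<beta> "u 0"] t Uu by simp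
      also have "\<dots> \<le> M * e" using \<beta> M by (intro mult_left_mono) auto
      finally have "\<bar>U \<beta> t - u t\<bar> \<le> u r - s" using M by (simp add: e_def)
      then show ?thesis using r(2)[OF t] by simp
    qed
    have "vu pi - V \<beta> pi > 0"
    proof (rule growth_strict[of "\<lambda>t. u t - U \<beta> t" "\<lambda>t. vu t - V \<beta> t" "\<lambda>t. ?F t (u t) - ?F t (U \<beta> t)" 0 pi])
      show "((\<lambda>t. u t - U \<beta> t) has_real_derivative vu t - V \<beta> t) (at t)"
        "((\<lambda>t. vu t - V \<beta> t) has_real_derivative ?F t (u t) - ?F t (U \<beta> t)) (at t)" for t
        using ode_onD[OF ode_u] dU by (auto intro!: DERIV_diff)
      show "?F t (u t) - ?F t (U \<beta> t) > 0" if "t \<in> {0..pi}" "u t - U \<beta> t > 0" for t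
        using trunc_strict_mono[OF low[OF that(1)], of "u t" x t] that by simp
    qed (use U vu \<beta> in auto)
    then show thesis using that[of \<beta>] \<beta> vu by simp
  qed
  obtain \<alpha> where \<alpha>: "y 0 \<le> \<alpha>" "\<alpha> \<le> \<beta>" "V \<alpha> pi = 0"
    using IVT2'[of "\<lambda>\<alpha>. V \<alpha> pi" \<beta> 0 "y 0"] up \<beta> cont by force
  have le_b: "U \<alpha> t \<le> b" if "t \<in> {0..pi}" for t
    using max_principle[OF pi_gt_zero dUb dU(2), of \<alpha> t] above \<alpha> U that by force
  \<comment> \<open>Below \<open>x\<close> the truncated force is \<open>rhs t (x t)\<close> minus
    the gap \<open>x t - U \<alpha> t\<close>, so the gap has its own positive value as second
    derivative.\<close>
  have x_le: "x t \<le> U \<alpha> t" if "t \<in> {0..pi}" for t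
  proof -
    have "x t - U \<alpha> t \<le> 0"
    proof (rule max_principle_weak[OF pi_gt_zero, of "\<lambda>t. x t - U \<alpha> t" "\<lambda>t. vx t - V \<alpha> t" "\<lambda>t. rhs t (x t) - ?F t (U \<alpha> t)"])
      show "((\<lambda>t. x t - U \<alpha> t) has_real_derivative vx t - V \<alpha> t) (at t)"
        "((\<lambda>t. vx t - V \<alpha> t) has_real_derivative rhs t (x t) - ?F t (U \<alpha> t)) (at t)" for t
        using ode_onD[OF vx(1)] dU by (auto intro!: DERIV_diff)
      show "rhs t (x t) - ?F t (U \<alpha> t) > 0" if "x t - U \<alpha> t > 0" for t
        using that xb[of t] by (simp add: trunc_below)
    qed (use vx U \<alpha> that in auto)
    then show ?thesis by simp
  qed
  have "ode_on {0..pi} rhs (U \<alpha>) (V \<alpha>)"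
    by (rule ode_on_cong[OF ode_on_subset[OF U(1)]]) (use le_b x_le in \<open>auto simp: trunc_inside\<close>)
  moreover have "\<bar>U \<alpha> t\<bar> \<le> b" if "t \<in> {0..pi}" for t
    using le_b[OF that] x_le[OF that] x(2)[of t] by simp
  ultimately obtain w where w: "neumann w" "\<And>t. t \<in> {0..pi} \<Longrightarrow> w t = U \<alpha> t"
    using neumann_extension U(3) \<alpha>(3) by metis
  have w0: "w 0 = \<alpha>" using w(2)[of 0] U by simp
  have "x t < w t" for t
  proof (rule neumann_strict_order[OF x(1) w(1)])
    show "x t \<le> w t" if "t \<in> {0..pi}" for t using x_le[OF that] w(2)[OF that] by simp
    show "x \<noteq> w" using w0 \<alpha>(1) xy0 by auto
  qed
  moreover have "w t < u t" for t
  proof (rule neumann_strict_order[OF w(1) u(1)])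
    show "w t \<le> u t" if "t \<in> {0..pi}" for t using neumann_le_upper[OF u(1,2) w(1) that] .
    show "w \<noteq> u" using w0 \<alpha>(2) \<beta>(2) by auto
  qed
  ultimately show thesis using that w by blast
qed

text \<open>Different solutions have different values at \<open>0\<close>, and the two meet at
  \<open>pi/2\<close> at the latest, against the Wronskian comparison. The inner claim is
  generalised over both solutions so that either may start lower.\<close>

lemma middle_unique:
  assumes x: "ode_on UNIV rhs x vx" "vx 0 = 0" "x (pi/2) = 0" "\<And>t. 0 \<le> t \<Longrightarrow> t < pi/2 \<Longrightarrow> x t < 0"
    and y: "ode_on UNIV rhs y vy" "vy 0 = 0" "y (pi/2) = 0" "\<And>t. 0 \<le> t \<Longrightarrow> t < pi/2 \<Longrightarrow> y t < 0"
  shows "x = y"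
proof -
  have False
    if x: "ode_on UNIV rhs x vx" "vx 0 = 0" "x (pi/2) = 0" "\<And>t. 0 \<le> t \<Longrightarrow> t < pi/2 \<Longrightarrow> x t < 0"
    and y: "ode_on UNIV rhs y vy" "vy 0 = 0" "y (pi/2) = 0" "\<And>t. 0 \<le> t \<Longrightarrow> t < pi/2 \<Longrightarrow> y t < 0"
    and lt: "x 0 < y 0" for x y vx vy
  proof -
    have "continuous_on {0..pi/2} (\<lambda>t. x t - y t)"
      by (intro continuous_intros continuous_at_imp_continuous_on ballI DERIV_isCont[OF ode_onD(1)[OF x(1)]]
          DERIV_isCont[OF ode_onD(1)[OF y(1)]])
    then obtain m where m: "0 < m" "m \<le> pi/2" "x m - y m = 0" "\<And>t. 0 \<le> t \<Longrightarrow> t < m \<Longrightarrow> x t - y t < 0"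
      by (rule first_zero) (use x(3) y(3) lt in simp_all)
    have "y m \<le> 0" using y(3) y(4)[of m] m(1,2) by (metis less_eq_real_def)
    then show False
      using negative_solutions_meet[OF ode_on_subset[OF x(1)] x(2) ode_on_subset[OF y(1)] y(2) m(1,2) m(2)]
        m y(4) by force
  qed
  then have "x 0 = y 0" using x y by (metis linorder_neqE_linordered_idom)
  then show ?thesis using ode_unique[OF locally_lipschitz_rhs x(1) y(1)] x y by metis
qed

section \<open>Identification with the known solutions\<close>

lemma solves_onE:
  assumes "solves_on \<epsilon> lam UNIV u" "deriv u 0 = 0"
  obtains v where "ode_on UNIV rhs u v" "v 0 = 0" "\<And>t. v t = deriv u t"
proof -
  obtain v where v: "ode_on UNIV rhs u v" using assms by (auto simp: solves_on_iff)
  then have "v t = deriv u t" for t using DERIV_imp_deriv[OF ode_onD(1)[OF v]] by simp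
  then show ?thesis using that v assms by metis
qed

lemma outer_iff: "3 * x^2 - lam > 0 \<longleftrightarrow> s < \<bar>x\<bar>"
proof -
  have "3 * x^2 - lam > 0 \<longleftrightarrow> s^2 < \<bar>x\<bar>^2" using s(2) by auto
  also have "\<dots> \<longleftrightarrow> s < \<bar>x\<bar>" using s(1) by (metis abs_ge_zero abs_of_pos power_mono_iff not_less zero_less_numeral)
  finally show ?thesis .
qed

text \<open>A competitor also stays above \<open>s\<close> for \<open>t >= 0\<close>, where the
  right-hand side is strictly increasing, so boundedness forces equality.\<close>

lemma unique_upper:
  assumes u: "neumann u" "\<And>t. s < u t" "\<And>t. u t < b"
  shows "is_the_unique (upper_bounded_solution \<epsilon> lam) u"
  unfolding is_the_unique_def
proof (intro conjI allI impI)
  have "\<bar>u t\<bar> \<le> b" for t using u(2,3)[of t] s b by auto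
  then have "bounded (u ` {0..})" unfolding bounded_iff by auto
  moreover have "u t > 0 \<and> 3 * (u t)^2 - lam > 0" for t using u(2)[of t] s(1) by (simp only: outer_iff) simp
  ultimately show upper: "upper_bounded_solution \<epsilon> lam u"
    using neumann_periodic_solution[OF u(1)] by (simp add: upper_bounded_solution_def periodic_solution_def)
  fix w assume w: "upper_bounded_solution \<epsilon> lam w"
  then have ws: "s < w t" if "t \<ge> 0" for t using that outer_iff[of "w t"] by (force simp: upper_bounded_solution_def)
  obtain v where v: "ode_on UNIV rhs u v" "v 0 = 0" using u(1) by (rule neumannE)
  obtain z where z: "ode_on UNIV rhs w z" "z 0 = 0"
    using w unfolding upper_bounded_solution_def by (blast elim: solves_onE)
  show "w = u"
    by (rule bounded_solution_unique[OF locally_lipschitz_rhs z _ v])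
      (use upper w ws u(2) in \<open>auto simp: upper_bounded_solution_def intro!: rhs_strict_mono less_imp_le\<close>)
qed

lemma unique_lower:
  assumes u: "neumann u" "\<And>t. u t < - s" "\<And>t. - b < u t"
  shows "is_the_unique (lower_bounded_solution \<epsilon> lam) u"
  unfolding is_the_unique_def
proof (intro conjI allI impI)
  have "\<bar>u t\<bar> \<le> b" for t using u(2,3)[of t] s b by auto
  then have "bounded (u ` {0..})" unfolding bounded_iff by auto
  moreover have "u t < 0 \<and> 3 * (u t)^2 - lam > 0" for t using u(2)[of t] s(1) by (simp only: outer_iff) simp
  ultimately show lower: "lower_bounded_solution \<epsilon> lam u"
    using neumann_periodic_solution[OF u(1)] by (simp add: lower_bounded_solution_def periodic_solution_def)
  fix w assume w: "lower_bounded_solution \<epsilon> lam w"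
  then have ws: "w t < - s" if "t \<ge> 0" for t using that outer_iff[of "w t"] by (force simp: lower_bounded_solution_def)
  obtain v where v: "ode_on UNIV rhs u v" "v 0 = 0" using u(1) by (rule neumannE)
  obtain z where z: "ode_on UNIV rhs w z" "z 0 = 0"
    using w unfolding lower_bounded_solution_def by (blast elim: solves_onE)
  show "w = u"
    by (rule bounded_solution_unique[OF locally_lipschitz_rhs z _ v])
      (use lower w ws u(2) in \<open>auto simp: lower_bounded_solution_def intro!: rhs_strict_mono less_imp_le\<close>)
qed

text \<open>A competitor increases to the value \<open>0\<close> at \<open>pi/2\<close>, hence is
  negative before, and \<open>middle_unique\<close> applies.\<close>

lemma unique_middle:
  assumes u: "neumann u" "u (pi/2) = 0" "\<And>t. 0 \<le> t \<Longrightarrow> t < pi/2 \<Longrightarrow> u t < 0"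
  shows "is_the_unique (increasing_periodic_solution \<epsilon> lam) u"
  unfolding is_the_unique_def
proof (intro conjI allI impI)
  have per: "periodic_solution \<epsilon> lam u" "deriv u 0 = 0" using neumann_periodic_solution[OF u(1)] by auto
  then obtain v where v: "ode_on UNIV rhs u v" "v 0 = 0" "\<And>t. v t = deriv u t"
    using solves_onE[of u] by (auto simp: periodic_solution_def)
  then show "increasing_periodic_solution \<epsilon> lam u"
    using per u middle_increasing[OF v(1,2) u(2,3)] by (auto simp: increasing_periodic_solution_def)
  fix w assume w: "increasing_periodic_solution \<epsilon> lam w"
  then obtain z where z: "ode_on UNIV rhs w z" "z 0 = 0" "\<And>t. z t = deriv w t"
    using solves_onE[of w] by (auto simp: increasing_periodic_solution_def periodic_solution_def)
  have "w t < w (pi/2)" if t: "0 \<le> t" "t < pi/2" for t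
  proof (rule DERIV_pos_imp_increasing_open[OF t(2)])
    show "\<exists>y. (w has_real_derivative y) (at r) \<and> 0 < y" if "t < r" "r < pi/2" for r
      using ode_onD(1)[OF z(1), of r] z(3)[of r] w that t by (auto simp: increasing_periodic_solution_def)
    show "continuous_on {t..pi/2} w"
      by (intro continuous_at_imp_continuous_on ballI DERIV_isCont[OF ode_onD(1)[OF z(1)]])
  qed
  then show "w = u"
    using middle_unique[OF z(1,2) _ _ v(1,2) u(2,3)] w by (auto simp: increasing_periodic_solution_def)
qed

section \<open>The ordered family of five solutions\<close>

lemma five_solutions:
  assumes y: "ode_on {0..T} rhs y vy" "vy 0 = 0" "strict_mono_on {0..T} y" "y 0 < 0" "y T = b"
    and T: "0 < T" "T < pi/2"
  obtains u1 u2 u3 u4 u5 where "is_the_unique (lower_bounded_solution \<epsilon> lam) u1"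
    "is_the_unique (increasing_periodic_solution \<epsilon> lam) u3" "is_the_unique (upper_bounded_solution \<epsilon> lam) u5"
    "\<forall>u \<in> {u1, u2, u3, u4, u5}. neumann u" "\<forall>t. u1 t < u2 t \<and> u2 t < u3 t \<and> u3 t < u4 t \<and> u4 t < u5 t"
proof -
  obtain u5 where u5: "neumann u5" "\<And>t. s < u5 t" "\<And>t. u5 t < b" using ex_upper by blast
  obtain u3 where u3: "neumann u3" "u3 (pi/2) = 0" "\<And>t. 0 \<le> t \<Longrightarrow> t < pi/2 \<Longrightarrow> u3 t < 0"
    "\<And>t. \<bar>u3 t\<bar> \<le> b" "\<And>t. - u3 (pi - t) = u3 t" using ex_middle by blast
  obtain u4 where u4: "neumann u4" "\<And>t. u3 t < u4 t" "\<And>t. u4 t < u5 t"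
    using ex_above_middle[OF u3(1,4,3) u5 y T] by blast
  let ?u1 = "\<lambda>t. - u5 (pi - t)" and ?u2 = "\<lambda>t. - u4 (pi - t)"
  show thesis
  proof (rule that[of ?u1 u3 u5 ?u2 u4])
    show "is_the_unique (lower_bounded_solution \<epsilon> lam) ?u1"
      by (rule unique_lower[OF neumann_reflect[OF u5(1)]]) (use u5 in auto)
    show "is_the_unique (increasing_periodic_solution \<epsilon> lam) u3" using u3 by (intro unique_middle)
    show "is_the_unique (upper_bounded_solution \<epsilon> lam) u5" using u5 by (rule unique_upper)
    show "\<forall>u \<in> {?u1, ?u2, u3, u4, u5}. neumann u" using u3 u4 u5 neumann_reflect by auto
    \<comment> \<open>\<open>u3\<close> is its own image under the antisymmetry, so reflecting
      \<open>u3 < u4 < u5\<close> orders the lower three.\<close>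
    have "?u1 t < ?u2 t \<and> ?u2 t < u3 t" for t using u4(2,3)[of "pi - t"] u3(5)[of t] by linarith
    then show "\<forall>t. ?u1 t < ?u2 t \<and> ?u2 t < u3 t \<and> u3 t < u4 t \<and> u4 t < u5 t" using u4 by blast
  qed
qed

end

theorem theorem16:
  fixes \<epsilon> lam b :: real
  assumes "\<epsilon> > 0"
    and "b > 0" and "b^3 - lam * b - 1 > 0"
    and "lam > 3 / 2 powr (2/3)"
    and "\<exists>\<alpha> \<in> {smallest_root lam <..< - sqrt (lam/3)}. \<exists>T \<in> {0<..<pi/2}. \<exists>u.
           shoots_on \<epsilon> lam \<alpha> {0..T} u \<and> strict_mono_on {0..T} u \<and> u T = b"
  shows "\<exists>u1 u2 u3 u4 u5.
           is_the_unique (lower_bounded_solution \<epsilon> lam) u1 \<and>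
           is_the_unique (increasing_periodic_solution \<epsilon> lam) u3 \<and>
           is_the_unique (upper_bounded_solution \<epsilon> lam) u5 \<and>
           (\<forall>u \<in> {u1, u2, u3, u4, u5}. periodic_solution \<epsilon> lam u \<and> deriv u pi = 0) \<and>
           (\<forall>t. u1 t < u2 t \<and> u2 t < u3 t \<and> u3 t < u4 t \<and> u4 t < u5 t)"
proof -
  interpret forced_duffing \<epsilon> lam b using assms(1-4) by unfold_locales
  obtain \<alpha> T y where y: "\<alpha> < - s" "0 < T" "T < pi/2" "shoots_on \<epsilon> lam \<alpha> {0..T} y" "strict_mono_on {0..T} y" "y T = b"
    using assms(5) unfolding s_def by auto
  obtain vy where vy: "ode_on {0..T} rhs y vy" using y(4) by (auto simp: shoots_on_def solves_on_iff)
  \<comment> \<open>\<open>shoots_on\<close> gives the initial velocity as a one-sided derivative;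
    it is unique because \<open>T > 0\<close>, and so equals \<open>vy 0\<close>.\<close>
  have "(y has_real_derivative vy 0) (at 0 within {0..T})" "(y has_real_derivative 0) (at 0 within {0..T})"
    using vy y by (auto simp: ode_on_def shoots_on_def)
  moreover have "at 0 within {0..T} \<noteq> bot" using y(2) by (simp add: at_within_Icc_at_right trivial_limit_at_right_real)
  ultimately have "vy 0 = 0" by (rule has_field_derivative_unique)
  moreover have "y 0 < 0" using y s(1) by (simp add: shoots_on_def)
  ultimately obtain u1 u2 u3 u4 u5 where "is_the_unique (lower_bounded_solution \<epsilon> lam) u1"
    "is_the_unique (increasing_periodic_solution \<epsilon> lam) u3" "is_the_unique (upper_bounded_solution \<epsilon> lam) u5"
    "\<forall>u \<in> {u1, u2, u3, u4, u5}. neumann u" "\<forall>t. u1 t < u2 t \<and> u2 t < u3 t \<and> u3 t < u4 t \<and> u4 t < u5 t"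
    by (rule five_solutions[OF vy _ y(5) _ y(6,2,3)])
  then show ?thesis using neumann_periodic_solution by (intro exI[of _ u1] exI[of _ u2] exI[of _ u3] exI[of _ u4] exI[of _ u5]) auto
qed

end
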